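(* Let $\mathcal{E}$ be the elliptic curve over $\mathbb{Q}$ defined in $\mathbb{P}^2$ with homogeneous coordinates $(a:b:c)$ by $$q(a,b,c) = -c^3 - c^2(a+b) + c(a^2+ab+b^2) + (a^3+a^2b+ab^2+b^3)=0,$$ with identity element $O=(1:-1:0)$. The torsion subgroup of $\mathcal{E}(\mathbb{Q})$ is isomorphic to $\mathbb{Z}/2\mathbb{Z}$ and consists of the points $O$ and $D=(1:1:-1)$.
   Context: The curve $\mathcal{E}$ is a smooth plane cubic, and $O=(1:-1:0)$ is an inflexion point of it; the group law on $\mathcal{E}(\mathbb{Q})$ is the usual chord-and-tangent law with identity $O$, so that three points of $\mathcal{E}$ sum to $O$ if and only if they are the intersection points (with multiplicity) of $\mathcal{E}$ with a line. *)

theory Defs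
  imports "HOL-Computational_Algebra.Polynomial" "HOL-Library.Multiset"
    "HOL-Algebra.Elementary_Groups"
begin

definition smult3 :: "rat \<Rightarrow> rat \<times> rat \<times> rat \<Rightarrow> rat \<times> rat \<times> rat"
  where "smult3 k = (\<lambda>(a, b, c). (k * a, k * b, k * c))"

definition proportional :: "rat \<times> rat \<times> rat \<Rightarrow> rat \<times> rat \<times> rat \<Rightarrow> bool"
  where "proportional u v \<longleftrightarrow> u \<noteq> (0, 0, 0) \<and> (\<exists>k. k \<noteq> 0 \<and> v = smult3 k u)"

lemma part_equivp_proportional: "part_equivp proportional"
proof (rule part_equivpI)
  show "\<exists>x. proportional x x"
    by (rule exI[of _ "(1, 0, 0)"]) (auto simp: proportional_def smult3_def intro: exI[of _ 1])
  show "symp proportional"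
  proof (rule sympI)
    fix u v assume "proportional u v"
    then obtain k where k: "u \<noteq> (0, 0, 0)" "k \<noteq> 0" "v = smult3 k u"
      by (auto simp: proportional_def)
    then show "proportional v u"
      unfolding proportional_def
      by (intro conjI exI[of _ "inverse k"]) (auto simp: smult3_def split: prod.splits)
  qed
  show "transp proportional"
  proof (rule transpI)
    fix u v w assume "proportional u v" "proportional v w"
    then obtain k l where k: "u \<noteq> (0, 0, 0)" "k \<noteq> 0" "v = smult3 k u" "l \<noteq> 0" "w = smult3 l v"
      by (auto simp: proportional_def)
    then show "proportional u w"
      unfolding proportional_def
      by (intro conjI exI[of _ "l * k"]) (auto simp: smult3_def split: prod.splits)
  qed
qed

text \<open>The rational points of the projective plane. Lines are represented by points of
  the dual plane, which is a copy of the same type.\<close>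

quotient_type proj_plane = "rat \<times> rat \<times> rat" / partial: proportional
  by (rule part_equivp_proportional)

type_synonym proj_line = proj_plane

text \<open>The point \<open>(a : b : c)\<close>; meaningful only if the coordinates are not all zero.\<close>

definition hom_pt :: "rat \<Rightarrow> rat \<Rightarrow> rat \<Rightarrow> proj_plane"
  where "hom_pt a b c = abs_proj_plane (a, b, c)"

lift_definition lies_on :: "proj_plane \<Rightarrow> proj_line \<Rightarrow> bool"
  is "\<lambda>(a, b, c) (l, m, n). l * a + m * b + n * c = 0"
proof -
  fix u v l m assume "proportional u v" "proportional l m"
  then obtain j k where *: "j \<noteq> 0" "v = smult3 j u" "k \<noteq> 0" "m = smult3 k l"
    by (auto simp: proportional_def)
  obtain a b c where u: "u = (a, b, c)" by (cases u)
  obtain x y z where l: "l = (x, y, z)" by (cases l)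
  have "(k * x) * (j * a) + (k * y) * (j * b) + (k * z) * (j * c) = (j * k) * (x * a + y * b + z * c)"
    by (simp add: algebra_simps)
  then show "(case u of (a, b, c) \<Rightarrow> \<lambda>(l, m, n). l * a + m * b + n * c = 0) l =
      (case v of (a, b, c) \<Rightarrow> \<lambda>(l, m, n). l * a + m * b + n * c = 0) m"
    using * by (simp add: u l smult3_def)
qed

text \<open>The form is polymorphic because it is evaluated both at rational numbers and, to
  restrict it to a line, at polynomials in one variable.\<close>

definition q_form :: "'a::comm_ring_1 \<Rightarrow> 'a \<Rightarrow> 'a \<Rightarrow> 'a"
  where "q_form a b c = - (c^3) - c^2 * (a + b) + c * (a^2 + a * b + b^2)
    + (a^3 + a^2 * b + a * b^2 + b^3)"

lemma q_form_scale: "q_form (k * a) (k * b) (k * c) = k^3 * q_form a b c"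
  unfolding q_form_def by (simp add: algebra_simps power2_eq_square power3_eq_cube)

lift_definition on_curve :: "proj_plane \<Rightarrow> bool"
  is "\<lambda>(a, b, c). q_form a b c = 0"
  by (auto simp: proportional_def smult3_def q_form_scale)

text \<open>The restriction of the form to the line through \<open>u\<close> and \<open>v\<close>, in the affine
  parametrisation \<open>t \<mapsto> u + t v\<close> centred at \<open>u\<close>.\<close>

definition q_on_line :: "rat \<times> rat \<times> rat \<Rightarrow> rat \<times> rat \<times> rat \<Rightarrow> rat poly"
  where "q_on_line = (\<lambda>(a, b, c) (x, y, z). q_form [:a, x:] [:b, y:] [:c, z:])"

lemma order_pcompose_scale:
  fixes p :: "rat poly"
  assumes "m \<noteq> 0"
  shows "Polynomial.order 0 (pcompose p [:0, m:]) = Polynomial.order 0 p"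
proof (cases "p = 0")
  case False
  define n where "n = Polynomial.order 0 p"
  obtain r where r: "p = [:0, 1:]^n * r" "\<not> [:0, 1:] dvd r"
    using order_decomp[OF False, of 0] by (auto simp: n_def)
  have r0: "poly r 0 \<noteq> 0" using r(2) by (simp add: poly_eq_0_iff_dvd)
  have pow: "pcompose (f^i) g = pcompose f g ^ i" for f g :: "rat poly" and i
    by (induction i) (simp_all add: pcompose_mult pcompose_1)
  have eq: "pcompose p [:0, m:] = [:0, m:]^n * pcompose r [:0, m:]"
    by (simp add: r(1) pcompose_mult pow pcompose_pCons)
  have "[:0, m:] = smult m [:0, 1:]" by simp
  then have eq2: "pcompose p [:0, m:] = smult (m^n) ([:0, 1:]^n * pcompose r [:0, m:])"
    using eq by (simp only: smult_power mult_smult_left)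
  have nz: "pcompose r [:0, m:] \<noteq> 0" using r0 by (auto dest: arg_cong[of _ _ "\<lambda>p. poly p 0"] simp: poly_pcompose)
  have "Polynomial.order 0 (pcompose r [:0, m:]) = 0"
    using r0 by (simp add: order_0I poly_pcompose)
  then show ?thesis
    using assms nz order_power_n_n[of "0::rat" n] by (simp add: eq2 order_smult order_mult n_def)
qed simp

text \<open>The intersection multiplicity at \<open>P\<close> of the curve and the line through \<open>P\<close> and
  \<open>V\<close>; meaningful only for \<open>P \<noteq> V\<close>.\<close>

lift_definition intersection_mult :: "proj_plane \<Rightarrow> proj_plane \<Rightarrow> nat"
  is "\<lambda>u v. Polynomial.order 0 (q_on_line u v)"
proof -
  fix u u' v v' assume "proportional u u'" "proportional v v'"
  then obtain j k where *: "j \<noteq> 0" "u' = smult3 j u" "k \<noteq> 0" "v' = smult3 k v"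
    by (auto simp: proportional_def)
  obtain a b c where u: "u = (a, b, c)" by (cases u)
  obtain x y z where v: "v = (x, y, z)" by (cases v)
  have lin: "[:j * s, k * t:] = [:j:] * pcompose [:s, t:] [:0, k / j:]" for s t
    using *(1) by (simp add: pcompose_pCons)
  have hom: "pcompose (q_form f g h) r = q_form (pcompose f r) (pcompose g r) (pcompose h r)"
    for f g h r :: "rat poly"
    by (simp add: q_form_def pcompose_add pcompose_diff pcompose_uminus pcompose_mult
        power2_eq_square power3_eq_cube)
  have "q_on_line u' v' = [:j:]^3 * pcompose (q_on_line u v) [:0, k / j:]"
    unfolding hom q_on_line_def using * by (simp only: u v smult3_def prod.case lin q_form_scale hom)
  also have "\<dots> = smult (j^3) (pcompose (q_on_line u v) [:0, k / j:])"
    by (simp add: power3_eq_cube mult.assoc)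
  finally show "Polynomial.order 0 (q_on_line u v) = Polynomial.order 0 (q_on_line u' v')"
    using * by (simp add: order_smult order_pcompose_scale)
qed

text \<open>\<open>P, Q, R\<close> are the intersection points, with multiplicity, of the curve with some line.
  Since the curve contains no line, each restriction \<open>q_on_line\<close> involved is nonzero
  (the order of the zero polynomial would be a junk value).\<close>

definition line_section :: "proj_plane \<Rightarrow> proj_plane \<Rightarrow> proj_plane \<Rightarrow> bool"
  where "line_section P Q R \<longleftrightarrow>
    (\<exists>L. lies_on P L \<and> lies_on Q L \<and> lies_on R L \<and>
      (\<forall>X V. lies_on X L \<and> lies_on V L \<and> X \<noteq> V \<longrightarrow>
        intersection_mult X V = count {#P, Q, R#} X))"

definition third_point :: "proj_plane \<Rightarrow> proj_plane \<Rightarrow> proj_plane"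
  where "third_point P Q = (THE R. line_section P Q R)"

text \<open>\<open>E(\<rat>)\<close> with the chord-and-tangent law: \<open>P + Q\<close> is the third point on the line
  through \<open>(1 : -1 : 0)\<close> and the third point on the line through \<open>P\<close> and \<open>Q\<close>.\<close>

definition curve_group :: "proj_plane monoid"
  where "curve_group =
    \<lparr>carrier = {P. on_curve P},
     monoid.mult = (\<lambda>P Q. third_point (hom_pt 1 (- 1) 0) (third_point P Q)),
     one = hom_pt 1 (- 1) 0\<rparr>"

definition torsion_points :: "('a, 'b) monoid_scheme \<Rightarrow> 'a set"
  where "torsion_points G = {x \<in> carrier G. \<exists>n::nat. n > 0 \<and> x [^]\<^bsub>G\<^esub> n = \<one>\<^bsub>G\<^esub>}"

end

theory Submission
  imports Defs "HOL-Number_Theory.Cong"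
begin

text \<open>In coordinates with \<open>O\<close> at infinity the curve becomes
  \<open>y\<^sup>2 = 4x\<^sup>3 + 5x\<^sup>2 - 8x\<close>, with \<open>D = (0, 0)\<close>. Full associativity of the
  chord-and-tangent law is not needed: the single identity \<open>A + (A + B) = (A + A) + B\<close> and
  the inverse property give \<open>(2m)P = mP + mP\<close> for the iterated sums of a point \<open>P\<close>.
  Hence the \<open>x\<close>-coordinate of a torsion point other than \<open>O\<close> and \<open>D\<close> has a finite orbit
  under the duplication map \<open>f(x) = (x\<^sup>2 + 2)\<^sup>2 / (x(4x\<^sup>2 + 5x - 8))\<close>.
  But \<open>f\<close> has no nonzero rational periodic point. If \<open>x\<close> has even denominator, then \<open>f\<close>
  strictly raises the power of 2 in it; if \<open>x\<close> is 2-adically divisible by 2, then no later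
  iterate is; and on the 2-adic units \<open>f\<close> is a contraction, so a periodic point is fixed,
  hence a root of \<open>3x\<^sup>4 + 5x\<^sup>3 - 12x\<^sup>2 - 4\<close>, whose homogenisation has no
  nontrivial zero modulo 5.\<close>

section \<open>Line sections of the curve\<close>

lemma hom_pt_eqI:
  assumes "(a, b, c) \<noteq> (0, 0, 0)" "(x, y, z) \<noteq> (0, 0, 0)"
    and "a * y = b * x" "a * z = c * x" "b * z = c * y"
  shows "hom_pt a b c = hom_pt x y z"
proof -
  have "\<exists>k. k \<noteq> 0 \<and> x = k * a \<and> y = k * b \<and> z = k * c"
  proof -
    consider "a \<noteq> 0" | "b \<noteq> 0" | "c \<noteq> 0" using assms(1) by auto
    then show ?thesis
    proof cases
      case 1
      then have "x = (x/a) * a" "y = (x/a) * b" "z = (x/a) * c" using assms by (auto simp: field_simps)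
      moreover from this have "x / a \<noteq> 0" using assms(2) by auto
      ultimately show ?thesis by blast
    next
      case 2
      then have "x = (y/b) * a" "y = (y/b) * b" "z = (y/b) * c" using assms by (auto simp: field_simps)
      moreover from this have "y / b \<noteq> 0" using assms(2) by auto
      ultimately show ?thesis by blast
    next
      case 3
      then have "x = (z/c) * a" "y = (z/c) * b" "z = (z/c) * c" using assms by (auto simp: field_simps)
      moreover from this have "z / c \<noteq> 0" using assms(2) by auto
      ultimately show ?thesis by blast
    qed
  qed
  then have "proportional (a, b, c) (x, y, z)"
    using assms(1) by (auto simp: proportional_def smult3_def)
  then show ?thesis
    unfolding hom_pt_def by (rule Quotient3_rel_abs[OF Quotient3_proj_plane])
qed

lemma proportional_refl: "u \<noteq> (0, 0, 0) \<Longrightarrow> proportional u u"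
  by (auto simp: proportional_def smult3_def intro!: exI[of _ 1] split: prod.splits)

lemma hom_pt_eq_iff:
  assumes "(a, b, c) \<noteq> (0, 0, 0)" "(x, y, z) \<noteq> (0, 0, 0)"
  shows "hom_pt a b c = hom_pt x y z \<longleftrightarrow> a * y = b * x \<and> a * z = c * x \<and> b * z = c * y"
proof
  assume "hom_pt a b c = hom_pt x y z"
  then have "proportional (a, b, c) (x, y, z)"
    using Quotient3_rel[OF Quotient3_proj_plane, of "(a, b, c)" "(x, y, z)"] assms proportional_refl
    by (auto simp: hom_pt_def)
  then show "a * y = b * x \<and> a * z = c * x \<and> b * z = c * y"
    by (auto simp: proportional_def smult3_def)
qed (use assms hom_pt_eqI in blast)

lemma hom_pt_cases:
  obtains a b c where "P = hom_pt a b c" "(a, b, c) \<noteq> (0, 0, 0)"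
proof -
  obtain a b c where *: "rep_proj_plane P = (a, b, c)" by (cases "rep_proj_plane P")
  have "P = hom_pt a b c"
    using Quotient3_abs_rep[OF Quotient3_proj_plane, of P] by (simp add: * hom_pt_def)
  moreover have "(a, b, c) \<noteq> (0, 0, 0)"
    using Quotient3_rep_reflp[OF Quotient3_proj_plane, of P] by (auto simp: * proportional_def)
  ultimately show ?thesis by (rule that)
qed

lemma lies_on_hom_pt:
  assumes "(a, b, c) \<noteq> (0, 0, 0)" "(l, m, n) \<noteq> (0, 0, 0)"
  shows "lies_on (hom_pt a b c) (hom_pt l m n) \<longleftrightarrow> l * a + m * b + n * c = 0"
  unfolding hom_pt_def using assms by (simp add: lies_on.abs_eq proportional_refl)

lemma on_curve_hom_pt:
  "(a, b, c) \<noteq> (0, 0, 0) \<Longrightarrow> on_curve (hom_pt a b c) \<longleftrightarrow> q_form a b c = 0"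
  unfolding hom_pt_def by (simp add: on_curve.abs_eq proportional_refl)

lemma intersection_mult_hom_pt:
  assumes "(a, b, c) \<noteq> (0, 0, 0)" "(x, y, z) \<noteq> (0, 0, 0)"
  shows "intersection_mult (hom_pt a b c) (hom_pt x y z)
    = Polynomial.order 0 (q_on_line (a, b, c) (x, y, z))"
  unfolding hom_pt_def using assms by (simp add: intersection_mult.abs_eq proportional_refl)

lemma ex_other_point:
  obtains V where "lies_on V L" "V \<noteq> P"
proof -
  obtain l m n where L: "L = hom_pt l m n" "(l, m, n) \<noteq> (0, 0, 0)" by (rule hom_pt_cases)
  have "\<exists>U V. lies_on U L \<and> lies_on V L \<and> U \<noteq> V"
  proof -
    consider "l \<noteq> 0" | "m \<noteq> 0" | "n \<noteq> 0" using L(2) by auto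
    then show ?thesis
    proof cases
      \<comment> \<open>The witnesses in the three cases are points where \<open>L\<close> meets
        coordinate lines; two of them differ as soon as the coefficient they share is
        nonzero.\<close>
      case 1 then show ?thesis using L
        by (intro exI[of _ "hom_pt m (-l) 0"] exI[of _ "hom_pt n 0 (-l)"])
           (simp add: lies_on_hom_pt hom_pt_eq_iff)
    next
      case 2 then show ?thesis using L
        by (intro exI[of _ "hom_pt m (-l) 0"] exI[of _ "hom_pt 0 n (-m)"])
           (simp add: lies_on_hom_pt hom_pt_eq_iff)
    next
      case 3 then show ?thesis using L
        by (intro exI[of _ "hom_pt n 0 (-l)"] exI[of _ "hom_pt 0 n (-m)"])
           (simp add: lies_on_hom_pt hom_pt_eq_iff)
    qed
  qed
  then show ?thesis using that by metis
qed

lemma line_unique: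
  assumes "P \<noteq> Q" "lies_on P L" "lies_on Q L" "lies_on P M" "lies_on Q M"
  shows "L = M"
proof -
  obtain a b c where P: "P = hom_pt a b c" "(a, b, c) \<noteq> (0, 0, 0)" by (rule hom_pt_cases)
  obtain x y z where Q: "Q = hom_pt x y z" "(x, y, z) \<noteq> (0, 0, 0)" by (rule hom_pt_cases)
  \<comment> \<open>The coefficients of the line through two points are the cross product of their
    coordinates, nonzero because the points differ.\<close>
  have *: "N = hom_pt (b*z - c*y) (c*x - a*z) (a*y - b*x)" if "lies_on P N" "lies_on Q N" for N
  proof -
    obtain l m n where N: "N = hom_pt l m n" "(l, m, n) \<noteq> (0, 0, 0)" by (rule hom_pt_cases)
    have 0: "l*a + m*b + n*c = 0" "l*x + m*y + n*z = 0"
      using that P Q N by (simp_all add: lies_on_hom_pt)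
    show ?thesis unfolding N(1)
    proof (rule hom_pt_eqI[OF N(2)])
      show "(b*z - c*y, c*x - a*z, a*y - b*x) \<noteq> (0, 0, 0)"
        using assms(1) P Q by (auto simp: hom_pt_eq_iff)
    qed (use 0 in algebra)+
  qed
  then show ?thesis using assms by metis
qed

text \<open>Taylor expansion of a cubic form along a line: the coefficient of t is the gradient at
  (a, b, c) applied to (x, y, z), and that of t^2 is the same with the points exchanged.\<close>

lemma q_on_line_eq:
  "q_on_line (a, b, c) (x, y, z) = [: q_form a b c,
     x * (-(c^2) + c * (2*a + b) + 3*a^2 + 2*a*b + b^2) +
     y * (-(c^2) + c * (a + 2*b) + a^2 + 2*a*b + 3*b^2) +
     z * (-3*c^2 - 2*c*(a + b) + a^2 + a*b + b^2),
     a * (-(z^2) + z * (2*x + y) + 3*x^2 + 2*x*y + y^2) +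
     b * (-(z^2) + z * (x + 2*y) + x^2 + 2*x*y + 3*y^2) +
     c * (-3*z^2 - 2*z*(x + y) + x^2 + x*y + y^2), q_form x y z :]"
  unfolding q_on_line_def q_form_def
  by (simp add: power2_eq_square power3_eq_cube algebra_simps)

text \<open>The three forms are the partial derivatives of \<open>q_form\<close>, so the curve has
  no singular rational point. The difference of the first two splits into linear factors, which
  gives the two cases.\<close>

lemma smooth:
  fixes a b c :: rat
  assumes "-(c^2) + c * (2*a + b) + 3*a^2 + 2*a*b + b^2 = 0"
    and "-(c^2) + c * (a + 2*b) + a^2 + 2*a*b + 3*b^2 = 0"
    and "-3*c^2 - 2*c*(a + b) + a^2 + a*b + b^2 = 0"
  shows "a = 0 \<and> b = 0 \<and> c = 0"
proof -
  have "(a - b) * (c + 2*a + 2*b) = 0" using assms(1,2) by algebra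
  then consider "a = b" | "c = - 2*a - 2*b" by fastforce
  then show ?thesis
  proof cases
    case 1
    have "a * (13*c + 15*a) = 0" using assms(1,3) unfolding 1[symmetric] by algebra
    moreover have "204 * a^2 = 0" if "13 * c + 15 * a = 0"
      using assms(1) that unfolding 1[symmetric] by algebra
    ultimately have "a = 0" by auto
    then show ?thesis using assms(1) 1 by auto
  next
    case 2
    have "a * b = 0" using assms unfolding 2 by algebra
    moreover have "5*a^2+12*a*b+5*b^2=0" using assms(1) unfolding 2 by algebra
    ultimately show ?thesis using 2 by auto
  qed
qed

text \<open>For distinct \<open>P\<close> and \<open>Q\<close> incidence determines the line. For
  \<open>P = Q\<close> the multiplicity at \<open>P\<close> is at least 2, so the line is the
  tangent given by the gradient. Once the lines agree, comparing multiplicities at \<open>R\<close>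
  gives \<open>R = S\<close>.\<close>

lemma line_section_unique:
  assumes R: "line_section P Q R" and S: "line_section P Q S"
  shows "R = S"
proof -
  obtain L where L: "lies_on P L" "lies_on Q L" "lies_on R L"
    "\<And>X V. lies_on X L \<Longrightarrow> lies_on V L \<Longrightarrow> X \<noteq> V \<Longrightarrow> intersection_mult X V = count {#P, Q, R#} X"
    using R unfolding line_section_def by blast
  obtain M where M: "lies_on P M" "lies_on Q M" "lies_on S M"
    "\<And>X V. lies_on X M \<Longrightarrow> lies_on V M \<Longrightarrow> X \<noteq> V \<Longrightarrow> intersection_mult X V = count {#P, Q, S#} X"
    using S unfolding line_section_def by blast
  have "L = M"
  proof (cases "P = Q")
    case True
    show ?thesis
    proof (rule ccontr)
      assume ne: "L \<noteq> M"
      obtain V where V: "lies_on V L" "V \<noteq> P" by (rule ex_other_point)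
      obtain W where W: "lies_on W M" "W \<noteq> P" by (rule ex_other_point)
      obtain a b c where P: "P = hom_pt a b c" "(a, b, c) \<noteq> (0, 0, 0)" by (rule hom_pt_cases)
      define qa where "qa = -(c^2) + c * (2*a + b) + 3*a^2 + 2*a*b + b^2"
      define qb where "qb = -(c^2) + c * (a + 2*b) + a^2 + 2*a*b + 3*b^2"
      define qc where "qc = -3*c^2 - 2*c*(a + b) + a^2 + a*b + b^2"
      have nz: "(qa, qb, qc) \<noteq> (0, 0, 0)" using smooth[of c a b, folded qa_def qb_def qc_def] P(2) by auto
      \<comment> \<open>Multiplicity at least 2 makes the first two coefficients in
        \<open>q_on_line_eq\<close> vanish; the second one says that \<open>U\<close> is on the
        tangent.\<close>
      have *: "q_form a b c = 0 \<and> lies_on U (hom_pt qa qb qc)" if "intersection_mult P U \<ge> 2" for U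
      proof -
        obtain x y z where U: "U = hom_pt x y z" "(x, y, z) \<noteq> (0, 0, 0)" by (rule hom_pt_cases)
        have "[:-0, 1:]^2 dvd q_on_line (a, b, c) (x, y, z)"
          using that P U unfolding order_divides by (simp add: intersection_mult_hom_pt)
        then obtain r where "q_on_line (a, b, c) (x, y, z) = [:0, 0, 1:] * r"
          by (auto simp: power2_eq_square dvd_def)
        then have "coeff (q_on_line (a, b, c) (x, y, z)) 0 = 0" "coeff (q_on_line (a, b, c) (x, y, z)) 1 = 0"
          by auto
        then show ?thesis using U nz unfolding q_on_line_eq
          by (simp add: lies_on_hom_pt qa_def qb_def qc_def algebra_simps)
      qed
      have V2: "intersection_mult P V \<ge> 2" using L V True by auto
      have W2: "intersection_mult P W \<ge> 2" using M W True by auto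
      \<comment> \<open>Euler's identity for a form of degree 3; it puts \<open>P\<close> itself on
        the tangent.\<close>
      have "3 * q_form a b c = qa * a + qb * b + qc * c"
        unfolding q_form_def qa_def qb_def qc_def by algebra
      then have "lies_on P (hom_pt qa qb qc)" using * V2 P nz by (simp add: lies_on_hom_pt)
      then have "L = hom_pt qa qb qc" "M = hom_pt qa qb qc"
        using * V2 W2 V W L M line_unique by metis+
      then show False using ne by simp
    qed
  qed (use L M line_unique in metis)
  obtain V where V: "lies_on V L" "V \<noteq> R" by (rule ex_other_point)
  then have "count {#P, Q, R#} R = count {#P, Q, S#} R"
    using L M \<open>L = M\<close> by metis
  then show ?thesis by (auto split: if_splits)
qed

text \<open>The points are given as intersections (cross products) of the line with the zero sets of
  the linear factors of the restricted form, so no parametrisation of the line is needed.\<close>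

lemma line_sectionI:
  fixes l m n :: rat and f g h :: "rat \<times> rat \<times> rat"
  assumes L: "(l, m, n) \<noteq> (0, 0, 0)" and "\<kappa> \<noteq> 0"
    and cross: "\<And>f1 f2 f3 S. (S, f1, f2, f3) \<in> {(P, f), (Q, g), (R, h)} \<Longrightarrow>
      S = hom_pt (m * f3 - n * f2) (n * f1 - l * f3) (l * f2 - m * f1) \<and>
      (m * f3 - n * f2, n * f1 - l * f3, l * f2 - m * f1) \<noteq> (0, 0, 0)"
    and q: "\<And>a b c. l * a + m * b + n * c = 0 \<Longrightarrow> q_form a b c = \<kappa> *
      (\<Prod>(f1, f2, f3)\<leftarrow>[f, g, h]. f1 * a + f2 * b + f3 * c)"
  shows "line_section P Q R"
proof -
  have lies: "lies_on S (hom_pt l m n)" if "(S, k) \<in> {(P, f), (Q, g), (R, h)}" for S k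
  proof -
    obtain f1 f2 f3 where "k = (f1, f2, f3)" by (cases k)
    then show ?thesis using cross[of S f1 f2 f3] that L by (auto simp: lies_on_hom_pt algebra_simps)
  qed
  have "intersection_mult X V = count {#P, Q, R#} X"
    if XV: "lies_on X (hom_pt l m n)" "lies_on V (hom_pt l m n)" "X \<noteq> V" for X V
  proof -
    obtain a b c where X: "X = hom_pt a b c" "(a, b, c) \<noteq> (0, 0, 0)" by (rule hom_pt_cases)
    obtain x y z where V: "V = hom_pt x y z" "(x, y, z) \<noteq> (0, 0, 0)" by (rule hom_pt_cases)
    have 0: "l * a + m * b + n * c = 0" "l * x + m * y + n * z = 0"
      using XV L X V by (simp_all add: lies_on_hom_pt)
    define lin where "lin = (\<lambda>(f1, f2, f3). [: f1 * a + f2 * b + f3 * c, f1 * x + f2 * y + f3 * z :])"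
    have "q_on_line (a, b, c) (x, y, z) = smult \<kappa> (lin f * lin g * lin h)"
    proof (rule poly_ext)
      fix t
      have "poly (q_on_line (a, b, c) (x, y, z)) t = q_form (a + t * x) (b + t * y) (c + t * z)"
        unfolding q_on_line_def q_form_def by simp algebra
      also have "\<dots> = \<kappa> * (\<Prod>(f1, f2, f3)\<leftarrow>[f, g, h]. f1 * (a + t * x) + f2 * (b + t * y) + f3 * (c + t * z))"
      proof (rule q)
        have "l * (a + t * x) + m * (b + t * y) + n * (c + t * z) =
           (l * a + m * b + n * c) + t * (l * x + m * y + n * z)" by algebra
        then show "l * (a + t * x) + m * (b + t * y) + n * (c + t * z) = 0" using 0 by simp
      qed
      also have "\<dots> = poly (smult \<kappa> (lin f * lin g * lin h)) t"
        by (cases f; cases g; cases h) (simp add: lin_def algebra_simps)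
      finally show "poly (q_on_line (a, b, c) (x, y, z)) t = poly (smult \<kappa> (lin f * lin g * lin h)) t" .
    qed
    \<comment> \<open>On the line the factor \<open>k\<close> vanishes only at \<open>S\<close>.
      Along X + tV, t = 0 is therefore a simple root if \<open>S = X\<close>, since then
      \<open>V\<close> differs from \<open>S\<close>, and no root otherwise.\<close>
    moreover have lin: "lin k \<noteq> 0 \<and> Polynomial.order 0 (lin k) = (if S = X then 1 else 0)"
      if "(S, k) \<in> {(P, f), (Q, g), (R, h)}" for S k
    proof -
      obtain f1 f2 f3 where k: "k = (f1, f2, f3)" by (cases k)
      define u where "u = m * f3 - n * f2"
      define v where "v = n * f1 - l * f3"
      define w where "w = l * f2 - m * f1"
      have S: "S = hom_pt u v w" "(u, v, w) \<noteq> (0, 0, 0)"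
        using cross[of S f1 f2 f3] that k by (auto simp: u_def v_def w_def)
      have iff: "hom_pt u v w = hom_pt i j r \<longleftrightarrow> f1 * i + f2 * j + f3 * r = 0"
        if "(i, j, r) \<noteq> (0, 0, 0)" "l * i + m * j + n * r = 0" for i j r
      proof -
        define F where "F = f1 * i + f2 * j + f3 * r"
        \<comment> \<open>Triple product expansion: once the line equation holds, the minors
          comparing (u, v, w) with (i, j, r) are \<open>F\<close> times l, m, n up to sign.\<close>
        have "u * j - v * i = f3 * (l * i + m * j + n * r) - n * F"
          "u * r - w * i = m * F - f2 * (l * i + m * j + n * r)"
          "v * r - w * j = f1 * (l * i + m * j + n * r) - l * F"
          unfolding u_def v_def w_def F_def by algebra+
        then have *: "u * j - v * i = - (n * F)" "u * r - w * i = m * F" "v * r - w * j = - (l * F)"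
          using that(2) by simp_all
        have "hom_pt u v w = hom_pt i j r \<longleftrightarrow> n * F = 0 \<and> m * F = 0 \<and> l * F = 0"
          unfolding hom_pt_eq_iff[OF S(2) that(1)]
          using * by (metis diff_eq_eq add_0 neg_equal_0_iff_equal right_minus_eq)
        then show ?thesis using L unfolding F_def[symmetric] by auto
      qed
      have X': "S = X \<longleftrightarrow> f1 * a + f2 * b + f3 * c = 0" using iff[of a b c] S X 0 by simp
      have V': "S = V \<longleftrightarrow> f1 * x + f2 * y + f3 * z = 0" using iff[of x y z] S V 0 by simp
      show ?thesis
      proof (cases "S = X")
        case True
        then have "f1 * x + f2 * y + f3 * z \<noteq> 0" using V' XV by auto
        moreover from this have "Polynomial.order 0 [:0, f1 * x + f2 * y + f3 * z:] = 1"
          using order_smult[of "f1 * x + f2 * y + f3 * z" 0 "[:0, 1:]"] order_power_n_n[of "0::rat" 1]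
          by simp
        ultimately show ?thesis using True X' by (simp add: lin_def k)
      next
        case False
        then show ?thesis using X' by (auto simp: lin_def k intro!: order_0I)
      qed
    qed
    moreover have "lin f \<noteq> 0" "lin g \<noteq> 0" "lin h \<noteq> 0" using lin by blast+
    moreover have ord: "Polynomial.order 0 (lin f) = (if P = X then 1 else 0)"
      "Polynomial.order 0 (lin g) = (if Q = X then 1 else 0)"
      "Polynomial.order 0 (lin h) = (if R = X then 1 else 0)" using lin by blast+
    ultimately have "lin f * lin g * lin h \<noteq> 0" and o:
      "Polynomial.order 0 (q_on_line (a, b, c) (x, y, z)) = Polynomial.order 0 (lin f * lin g * lin h)"
      using \<open>\<kappa> \<noteq> 0\<close> by (simp_all add: order_smult)
    then have "Polynomial.order 0 (lin f * lin g * lin h) =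
      Polynomial.order 0 (lin f) + Polynomial.order 0 (lin g) + Polynomial.order 0 (lin h)"
      by (simp add: order_mult)
    also have "\<dots> = count {#P, Q, R#} X" unfolding ord by simp
    finally have "Polynomial.order 0 (q_on_line (a, b, c) (x, y, z)) = count {#P, Q, R#} X"
      unfolding o .
    then show ?thesis using X V by (simp add: intersection_mult_hom_pt)
  qed
  then show ?thesis unfolding line_section_def using lies[of P f] lies[of Q g] lies[of R h]
    by (intro exI[of _ "hom_pt l m n"]) simp
qed

section \<open>Weierstrass coordinates\<close>

text \<open>Inverse of x = (a+b+2c)/(2a+2b+c), y = 3(a-b)/(2a+2b+c). The denominator vanishes on the
  tangent at the inflexion point (1:-1:0), which becomes the point at infinity.\<close>

definition pt :: "rat \<Rightarrow> rat \<Rightarrow> proj_plane"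
  where "pt x y = hom_pt (2 - x + y) (2 - x - y) (4 * x - 2)"

abbreviation (input) pinf :: proj_plane where "pinf \<equiv> hom_pt 1 (- 1) 0"

definition wcurve :: "rat \<Rightarrow> rat \<Rightarrow> bool"
  where "wcurve x y \<longleftrightarrow> y^2 = 4 * x^3 + 5 * x^2 - 8 * x"

lemma pt_nonzero: "(2 - x + y, 2 - x - y, 4 * x - 2) \<noteq> (0::rat, 0, 0)"
proof
  assume "(2 - x + y, 2 - x - y, 4 * x - 2) = (0, 0, 0)"
  then have "2 - x + y + (2 - x - y) = 0" "4 * x - 2 = 0" by simp_all
  then show False by simp
qed

lemma pt_eq_iff [simp]: "pt x y = pt x' y' \<longleftrightarrow> x = x' \<and> y = y'"
proof
  assume "pt x y = pt x' y'"
  then have *: "(2 - x + y) * (2 - x' - y') = (2 - x - y) * (2 - x' + y')"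
    "(2 - x + y) * (4 * x' - 2) = (4 * x - 2) * (2 - x' + y')"
    "(2 - x - y) * (4 * x' - 2) = (4 * x - 2) * (2 - x' - y')"
    unfolding pt_def by (auto simp: hom_pt_eq_iff pt_nonzero)
  have "12 * (x' - x) = ((2 - x + y) * (4 * x' - 2) - (4 * x - 2) * (2 - x' + y')) +
    ((2 - x - y) * (4 * x' - 2) - (4 * x - 2) * (2 - x' - y'))" by algebra
  then have x: "x = x'" using * by simp
  have "(2 - x) * (y - y') = 0" "(4 * x - 2) * (y - y') = 0" using * unfolding x by algebra+
  then show "x = x' \<and> y = y'" using x by auto
qed simp

lemma pt_neq_pinf [simp]: "pt x y \<noteq> pinf" "pinf \<noteq> pt x y"
  using pt_nonzero[of x y] by (auto simp: pt_def hom_pt_eq_iff)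

text \<open>With X, Y, W for the linear forms a+b+2c, 3(a-b), 2a+2b+c, this is the homogenised
  Weierstrass equation.\<close>

lemma q_form_weierstrass:
  fixes a b c :: rat
  shows "36 * q_form a b c = (3 * (a - b))^2 * (2*a + 2*b + c) - 4 * (a + b + 2*c)^3
    - 5 * (a + b + 2*c)^2 * (2*a + 2*b + c) + 8 * (a + b + 2*c) * (2*a + 2*b + c)^2"
  unfolding q_form_def by algebra

lemma on_curve_pt: "on_curve (pt x y) \<longleftrightarrow> wcurve x y"
proof -
  have "q_form (2 - x + y) (2 - x - y) (4 * x - 2) = 6 * (y^2 - (4 * x^3 + 5 * x^2 - 8 * x))"
    unfolding q_form_def by algebra
  then have "on_curve (pt x y) \<longleftrightarrow> 6 * (y^2 - (4 * x^3 + 5 * x^2 - 8 * x)) = 0"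
    by (simp only: pt_def on_curve_hom_pt[OF pt_nonzero])
  then show ?thesis unfolding wcurve_def mult_eq_0_iff by simp
qed

lemma on_curve_pinf: "on_curve pinf"
  by (simp add: on_curve_hom_pt q_form_def)

lemma on_curve_cases:
  assumes "on_curve P"
  obtains "P = pinf" | x y where "P = pt x y" "wcurve x y"
proof -
  obtain a b c where P: "P = hom_pt a b c" "(a, b, c) \<noteq> (0, 0, 0)" by (rule hom_pt_cases)
  have q: "q_form a b c = 0" using assms P by (simp add: on_curve_hom_pt)
  define w where "w = 2*a + 2*b + c"
  show ?thesis
  proof (cases "w = 0")
    case True
    then have "4 * (a + b + 2*c)^3 = 0" using q_form_weierstrass[of a b c] q by (simp add: w_def)
    then have *: "a + b + 2*c = 0" "2*a + 2*b + c = 0" using True by (simp_all add: w_def)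
    then have "c = 0" "b = -a" by simp_all
    then have "P = pinf" using P by (auto simp: hom_pt_eq_iff)
    then show ?thesis by (rule that)
  next
    case False
    define x where "x = (a + b + 2*c) / w"
    define y where "y = 3 * (a - b) / w"
    have "x * w = a + b + 2*c" "y * w = 3 * (a - b)" using False by (simp_all add: x_def y_def)
    then have abc: "6 * a = (2 - x + y) * w" "6 * b = (2 - x - y) * w" "6 * c = (4 * x - 2) * w"
      unfolding left_diff_distrib distrib_right mult.assoc by (simp_all add: w_def)
    have "P = pt x y" unfolding P(1) pt_def
      by (rule hom_pt_eqI[OF P(2) pt_nonzero]) (use abc in algebra)+
    then show ?thesis using assms on_curve_pt that by metis
  qed
qed

text \<open>On the line at infinity W = 0 the form is -X^3/9, so O is a triple intersection.\<close>

lemma line_section_pinf: "line_section pinf pinf pinf"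
proof (rule line_sectionI[where l=2 and m=2 and n=1 and f="(1,1,2)" and g="(1,1,2)" and h="(1,1,2)"
      and \<kappa>="-1/9"])
  fix a b c :: rat
  assume "2 * a + 2 * b + 1 * c = 0"
  then have c: "c = - 2 * a - 2 * b" by simp
  show "q_form a b c = -1/9 * (\<Prod>(f1, f2, f3)\<leftarrow>[(1,1,2), (1,1,2), (1,1,2)]. f1 * a + f2 * b + f3 * c)"
    using q_form_weierstrass[of a b c] unfolding c by (simp add: power3_eq_cube)
qed (auto simp: hom_pt_eq_iff)

text \<open>The line is X = xW; on it the form splits into W, Y - yW and Y + yW, the three factors
  supplied.\<close>

lemma line_section_vertical:
  assumes "wcurve x y"
  shows "line_section pinf (pt x y) (pt x (- y))"
proof (rule line_sectionI[where l="1 - 2*x" and m="1 - 2*x" and n="2 - x" and f="(2,2,1)"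
      and g="(3-2*y,-3-2*y,-y)" and h="(3+2*y,-3+2*y,y)" and \<kappa>="1/36"])
  show "(1 - 2*x, 1 - 2*x, 2 - x) \<noteq> (0, 0, 0)" by auto
next
  fix a b c
  assume *: "(1 - 2*x) * a + (1 - 2*x) * b + (2 - x) * c = 0"
  define X Y W where "X = a + b + 2*c" and "Y = 3 * (a - b)" and "W = 2*a + 2*b + c"
  have X: "X = x * W" using * unfolding X_def W_def by algebra
  have "36 * q_form a b c = Y^2 * W - 4 * X^3 - 5 * X^2 * W + 8 * X * W^2"
    unfolding q_form_weierstrass X_def Y_def W_def ..
  also have "\<dots> = W * (Y - y * W) * (Y + y * W)"
    using assms unfolding X wcurve_def by algebra
  finally have "q_form a b c = 1/36 * (W * (Y - y * W) * (Y + y * W))" by simp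
  then show "q_form a b c = 1/36 * (\<Prod>(f1, f2, f3)\<leftarrow>[(2,2,1), (3-2*y,-3-2*y,-y), (3+2*y,-3+2*y,y)].
      f1 * a + f2 * b + f3 * c)"
    by (simp add: X_def Y_def W_def algebra_simps)
next
  fix f1 f2 f3 P
  have *: "pt x y = hom_pt ((1-2*x) * -y - (2-x) * (-3-2*y)) ((2-x) * (3-2*y) - (1-2*x) * -y)
          ((1-2*x) * (-3-2*y) - (1-2*x) * (3-2*y)) \<and>
      ((1-2*x) * -y - (2-x) * (-3-2*y), (2-x) * (3-2*y) - (1-2*x) * -y,
          (1-2*x) * (-3-2*y) - (1-2*x) * (3-2*y)) \<noteq> (0, 0, 0)" for y
  proof -
    have e: "(1-2*x) * -y - (2-x) * (-3-2*y) = 3 * (2 - x + y)"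
      "(2-x) * (3-2*y) - (1-2*x) * -y = 3 * (2 - x - y)"
      "(1-2*x) * (-3-2*y) - (1-2*x) * (3-2*y) = 3 * (4 * x - 2)" by algebra+
    have nz: "(3 * (2 - x + y), 3 * (2 - x - y), 3 * (4 * x - 2)) \<noteq> (0, 0, 0)"
      using pt_nonzero[of x y] by auto
    show ?thesis unfolding e pt_def
      by (intro conjI hom_pt_eqI pt_nonzero nz) algebra+
  qed
  assume "(P, f1, f2, f3) \<in> {(pinf, 2, 2, 1), (pt x y, 3-2*y, -3-2*y, -y), (pt x (-y), 3+2*y, -3+2*y, y)}"
  then consider "P = pinf" "f1 = 2" "f2 = 2" "f3 = 1"
    | "P = pt x y" "f1 = 3-2*y" "f2 = -3-2*y" "f3 = -y"
    | "P = pt x (-y)" "f1 = 3+2*y" "f2 = -3+2*y" "f3 = y" by auto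
  then show "P = hom_pt ((1-2*x) * f3 - (2-x) * f2) ((2-x) * f1 - (1-2*x) * f3)
          ((1-2*x) * f2 - (1-2*x) * f1) \<and>
      ((1-2*x) * f3 - (2-x) * f2, (2-x) * f1 - (1-2*x) * f3, (1-2*x) * f2 - (1-2*x) * f1) \<noteq> (0, 0, 0)"
  proof cases
    case 1 then show ?thesis by (simp add: hom_pt_eq_iff algebra_simps)
  next
    case 2 show ?thesis unfolding 2 by (rule *)
  next
    case 3 show ?thesis unfolding 3 using *[of "-y"] by simp
  qed
qed simp

text \<open>The hypotheses are Vieta's relations for 4x^3 + 5x^2 - 8x = (sx + r)^2, so on the line Y
  = sX + rW the form splits into the factors X - x_i W. Repeated roots are allowed.\<close>

lemma line_section_slanted:
  assumes "x1 + x2 + x3 = (s^2 - 5) / 4" "x1 * x2 + x1 * x3 + x2 * x3 = - 2 - s * r / 2"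
    "x1 * x2 * x3 = r^2 / 4"
  shows "line_section (pt x1 (s * x1 + r)) (pt x2 (s * x2 + r)) (pt x3 (s * x3 + r))"
proof (rule line_sectionI[where l="3 - s - 2*r" and m="-3 - s - 2*r" and n="-2*s - r"
      and f="(1-2*x1,1-2*x1,2-x1)" and g="(1-2*x2,1-2*x2,2-x2)" and h="(1-2*x3,1-2*x3,2-x3)"
      and \<kappa>="-1/9"])
  show "(3 - s - 2*r, -3 - s - 2*r, -2*s - r) \<noteq> (0, 0, 0)" by auto
next
  fix a b c
  assume *: "(3 - s - 2*r) * a + (-3 - s - 2*r) * b + (-2*s - r) * c = 0"
  define X Y W where "X = a + b + 2*c" and "Y = 3 * (a - b)" and "W = 2*a + 2*b + c"
  have Y: "Y = s * X + r * W" using * unfolding X_def Y_def W_def by algebra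
  have "36 * q_form a b c = Y^2 * W - 4 * X^3 - 5 * X^2 * W + 8 * X * W^2"
    unfolding q_form_weierstrass X_def Y_def W_def ..
  also have "\<dots> = - 4 * (X^3 - (x1 + x2 + x3) * X^2 * W + (x1 * x2 + x1 * x3 + x2 * x3) * X * W^2
      - x1 * x2 * x3 * W^3)"
    unfolding Y assms by (simp add: field_simps power2_eq_square power3_eq_cube)
  also have "\<dots> = - 4 * ((X - x1 * W) * (X - x2 * W) * (X - x3 * W))"
    by algebra
  finally have "q_form a b c = -1/9 * ((X - x1 * W) * (X - x2 * W) * (X - x3 * W))" by simp
  then show "q_form a b c = -1/9 * (\<Prod>(f1, f2, f3)\<leftarrow>[(1-2*x1,1-2*x1,2-x1), (1-2*x2,1-2*x2,2-x2),
      (1-2*x3,1-2*x3,2-x3)]. f1 * a + f2 * b + f3 * c)"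
    by (simp add: X_def W_def algebra_simps)
next
  fix f1 f2 f3 P
  let ?l = "3 - s - 2*r" and ?m = "-3 - s - 2*r" and ?n = "-2*s - r"
  have *: "pt x (s * x + r) = hom_pt (?m * (2-x) - ?n * (1-2*x)) (?n * (1-2*x) - ?l * (2-x))
          (?l * (1-2*x) - ?m * (1-2*x)) \<and>
      (?m * (2-x) - ?n * (1-2*x), ?n * (1-2*x) - ?l * (2-x), ?l * (1-2*x) - ?m * (1-2*x)) \<noteq> (0, 0, 0)" for x
  proof -
    define y where "y = s * x + r"
    have e: "?m * (2-x) - ?n * (1-2*x) = -3 * (2 - x + y)"
      "?n * (1-2*x) - ?l * (2-x) = -3 * (2 - x - y)"
      "?l * (1-2*x) - ?m * (1-2*x) = -3 * (4 * x - 2)" unfolding y_def by algebra+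
    have nz: "(-3 * (2 - x + y), -3 * (2 - x - y), -3 * (4 * x - 2)) \<noteq> (0, 0, 0)"
      using pt_nonzero[of x y] by auto
    show ?thesis unfolding e pt_def y_def[symmetric]
      by (intro conjI hom_pt_eqI pt_nonzero nz) algebra+
  qed
  assume "(P, f1, f2, f3) \<in> {(pt x1 (s * x1 + r), 1-2*x1, 1-2*x1, 2-x1),
     (pt x2 (s * x2 + r), 1-2*x2, 1-2*x2, 2-x2), (pt x3 (s * x3 + r), 1-2*x3, 1-2*x3, 2-x3)}"
  then obtain x where "P = pt x (s * x + r)" "f1 = 1-2*x" "f2 = 1-2*x" "f3 = 2-x" by auto
  then show "P = hom_pt (?m * f3 - ?n * f2) (?n * f1 - ?l * f3) (?l * f2 - ?m * f1) \<and>
      (?m * f3 - ?n * f2, ?n * f1 - ?l * f3, ?l * f2 - ?m * f1) \<noteq> (0, 0, 0)"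
    using *[of x] by simp
qed simp

lemma third_point_eqI: "line_section P Q R \<Longrightarrow> third_point P Q = R"
  unfolding third_point_def using line_section_unique by blast

lemma line_section_perm: "{#P, Q, R#} = {#P', Q', R'#} \<Longrightarrow> line_section P Q R \<Longrightarrow> line_section P' Q' R'"
proof -
  assume *: "{#P, Q, R#} = {#P', Q', R'#}" "line_section P Q R"
  have "{P, Q, R} = {P', Q', R'}" using arg_cong[OF *(1), of set_mset] by simp
  moreover have "lies_on P L \<and> lies_on Q L \<and> lies_on R L \<longleftrightarrow> (\<forall>X\<in>{P, Q, R}. lies_on X L)" for P Q R L
    by simp
  ultimately show ?thesis using *(2) unfolding line_section_def *(1) by (metis (lifting))
qed

lemma line_section_swap: "line_section P Q R \<Longrightarrow> line_section Q P R"
  and line_section_rot: "line_section P Q R \<Longrightarrow> line_section Q R P"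
  by (auto elim!: line_section_perm[rotated] simp: add_mset_commute)

lemma third_point_commute: "third_point P Q = third_point Q P"
proof -
  have "line_section P Q = line_section Q P" using line_section_swap by blast
  then show ?thesis by (simp add: third_point_def)
qed

section \<open>The chord-and-tangent law\<close>

lemma third_point_pinf: "third_point pinf pinf = pinf"
  by (rule third_point_eqI[OF line_section_pinf])

lemma third_point_pinf_pt: "wcurve x y \<Longrightarrow> third_point pinf (pt x y) = pt x (- y)"
  by (rule third_point_eqI[OF line_section_vertical])

lemma third_point_vertical: "wcurve x y \<Longrightarrow> third_point (pt x y) (pt x (- y)) = pinf"
  by (rule third_point_eqI[OF line_section_rot[OF line_section_vertical]])

text \<open>Hypothesis \<open>e\<close> says that \<open>x2\<close> is a root of what remains of the
  cubic for the x-coordinates on the line after division by x - x1. This treats the chord and the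
  tangent (\<open>x1 = x2\<close>) at once.\<close>

lemma line_section_affine:
  assumes "wcurve x1 y1"
    and e: "4 * (x1^2 + x1 * x2 + x2^2) + (5 - s^2) * (x1 + x2) - 8 - 2 * s * (y1 - s * x1) = 0"
    and x3: "4 * x3 = s^2 - 5 - 4 * x1 - 4 * x2"
  shows "line_section (pt x1 y1) (pt x2 (y1 + s * (x2 - x1))) (pt x3 (y1 + s * (x3 - x1)))"
    and "wcurve x3 (y1 + s * (x3 - x1))"
proof -
  define r where "r = y1 - s * x1"
  have e2: "4 * (x1 * x2 + x1 * x3 + x2 * x3) = - 8 - 2 * s * r"
    using e x3 unfolding r_def by algebra
  have e3: "4 * (x1 * x2 * x3) = r^2"
    using e2 x3 assms(1) unfolding r_def wcurve_def by algebra
  have y: "y1 + s * (x - x1) = s * x + r" for x unfolding r_def by algebra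
  have "line_section (pt x1 (s * x1 + r)) (pt x2 (s * x2 + r)) (pt x3 (s * x3 + r))"
    using x3 e2 e3 by (intro line_section_slanted) simp_all
  then show "line_section (pt x1 y1) (pt x2 (y1 + s * (x2 - x1))) (pt x3 (y1 + s * (x3 - x1)))"
    unfolding y by (simp add: r_def)
  show "wcurve x3 (y1 + s * (x3 - x1))"
    using x3 e2 e3 unfolding y wcurve_def by algebra
qed

lemma chord:
  assumes "wcurve x1 y1" "wcurve x2 (y1 + s * (x2 - x1))" "x1 \<noteq> x2"
    and "4 * x3 = s^2 - 5 - 4 * x1 - 4 * x2"
  shows "line_section (pt x1 y1) (pt x2 (y1 + s * (x2 - x1))) (pt x3 (y1 + s * (x3 - x1)))"
    and "wcurve x3 (y1 + s * (x3 - x1))"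
proof -
  have "(x2 - x1) * (4 * (x1^2 + x1 * x2 + x2^2) + (5 - s^2) * (x1 + x2) - 8 - 2 * s * (y1 - s * x1)) = 0"
    using assms(1,2) unfolding wcurve_def by algebra
  then have e: "4 * (x1^2 + x1 * x2 + x2^2) + (5 - s^2) * (x1 + x2) - 8 - 2 * s * (y1 - s * x1) = 0"
    using assms(3) by simp
  show "line_section (pt x1 y1) (pt x2 (y1 + s * (x2 - x1))) (pt x3 (y1 + s * (x3 - x1)))"
    "wcurve x3 (y1 + s * (x3 - x1))"
    using line_section_affine[OF assms(1) e assms(4)] by blast+
qed

lemma tangent:
  assumes "wcurve x y" "2 * y * s = 12 * x^2 + 10 * x - 8" "4 * x3 = s^2 - 5 - 8 * x"
  shows "line_section (pt x y) (pt x y) (pt x3 (y + s * (x3 - x)))"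
    and "wcurve x3 (y + s * (x3 - x))"
proof -
  have e: "4 * (x^2 + x * x + x^2) + (5 - s^2) * (x + x) - 8 - 2 * s * (y - s * x) = 0"
    using assms(2) by algebra
  show "line_section (pt x y) (pt x y) (pt x3 (y + s * (x3 - x)))"
    "wcurve x3 (y + s * (x3 - x))"
    using line_section_affine[OF assms(1) e, of x3] assms(3) by simp_all
qed

lemma wcurve_minus [simp]: "wcurve x (- y) \<longleftrightarrow> wcurve x y"
  by (simp add: wcurve_def)

lemma wcurve_same_x: "wcurve x y \<Longrightarrow> wcurve x y' \<Longrightarrow> y' = y \<or> y' = - y"
  by (metis power2_eq_iff wcurve_def)

lemma ex_line_section:
  assumes "on_curve P" "on_curve Q"
  shows "\<exists>R. on_curve R \<and> line_section P Q R"
  using assms(1)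
proof (cases rule: on_curve_cases)
  case P: 1
  show ?thesis using assms(2)
  proof (cases rule: on_curve_cases)
    case 1 then show ?thesis using P line_section_pinf on_curve_pinf by blast
  next
    case (2 x y) then show ?thesis using P line_section_vertical on_curve_pt wcurve_minus by metis
  qed
next
  case P: (2 x1 y1)
  show ?thesis using assms(2)
  proof (cases rule: on_curve_cases)
    case 1 then show ?thesis
      using P line_section_swap[OF line_section_vertical[OF P(2)]] on_curve_pt wcurve_minus by metis
  next
    case Q: (2 x2 y2)
    \<comment> \<open>Points with equal x-coordinate are opposite or equal. A point with y = 0
      counts as its own opposite, so the tangent slope below has a nonzero denominator.\<close>
    consider "x1 \<noteq> x2" | "x2 = x1" "y2 = - y1" | "x2 = x1" "y2 = y1" "y1 \<noteq> 0"
      using wcurve_same_x P Q by (metis minus_zero)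
    then show ?thesis
    proof cases
      case 1
      define s where "s = (y2 - y1) / (x2 - x1)"
      have y2: "y2 = y1 + s * (x2 - x1)" using 1 by (simp add: s_def)
      have x3: "4 * ((s^2 - 5) / 4 - x1 - x2) = s^2 - 5 - 4 * x1 - 4 * x2" by simp
      show ?thesis unfolding P(1) Q(1) y2
        using chord[OF P(2) Q(2)[unfolded y2] 1 x3] on_curve_pt by blast
    next
      case 2
      then show ?thesis using P Q line_section_rot[OF line_section_vertical[OF P(2)]] on_curve_pinf by blast
    next
      case 3
      then show ?thesis using P Q tangent[of x1 y1 "(12 * x1^2 + 10 * x1 - 8) / (2 * y1)"
          "(((12 * x1^2 + 10 * x1 - 8) / (2 * y1))^2 - 5 - 8 * x1) / 4"] on_curve_pt by auto
    qed
  qed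
qed

lemma third_point_iff:
  assumes "on_curve P" "on_curve Q"
  shows "third_point P Q = R \<longleftrightarrow> line_section P Q R"
  using assms ex_line_section third_point_eqI by metis

lemma on_curve_third_point: "on_curve P \<Longrightarrow> on_curve Q \<Longrightarrow> on_curve (third_point P Q)"
  using ex_line_section third_point_eqI by metis

lemma third_point_cancel:
  "on_curve P \<Longrightarrow> on_curve Q \<Longrightarrow> third_point P (third_point P Q) = Q"
  using line_section_swap line_section_rot on_curve_third_point third_point_iff by metis

section \<open>Negation and addition\<close>

abbreviation (input) neg :: "proj_plane \<Rightarrow> proj_plane"
  where "neg P \<equiv> third_point pinf P"

abbreviation (input) add :: "proj_plane \<Rightarrow> proj_plane \<Rightarrow> proj_plane"
  where "add P Q \<equiv> neg (third_point P Q)"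

lemma on_curve_neg: "on_curve P \<Longrightarrow> on_curve (neg P)"
  by (intro on_curve_third_point on_curve_pinf)

lemma on_curve_add: "on_curve P \<Longrightarrow> on_curve Q \<Longrightarrow> on_curve (add P Q)"
  by (intro on_curve_third_point on_curve_pinf)

lemmas on_curve_intros = on_curve_pinf on_curve_third_point

lemma neg_neg: "on_curve P \<Longrightarrow> neg (neg P) = P"
  by (intro third_point_cancel on_curve_pinf)

text \<open>Negation is the reflection y -> -y, a symmetry of the curve taking chords and tangents
  of slope s to those of slope -s.\<close>

lemma third_point_neg:
  assumes "on_curve P" "on_curve Q"
  shows "third_point (neg P) (neg Q) = neg (third_point P Q)"
  using assms(1)
proof (cases rule: on_curve_cases)
  case 1
  then show ?thesis using assms by (simp add: third_point_pinf)
next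
  case P: (2 x1 y1)
  show ?thesis using assms(2)
  proof (cases rule: on_curve_cases)
    case 1 then show ?thesis using assms
      by (simp add: third_point_pinf third_point_commute[of "neg P"] third_point_commute[of P])
  next
    case Q: (2 x2 y2)
    have negs: "neg P = pt x1 (- y1)" "neg Q = pt x2 (- y2)" using P Q by (simp_all add: third_point_pinf_pt)
    consider "x1 \<noteq> x2" | "x2 = x1" "y2 = - y1" | "x2 = x1" "y2 = y1" "y1 \<noteq> 0"
      using wcurve_same_x P Q by (metis minus_zero)
    then show ?thesis
    proof cases
      case 1
      define s where "s = (y2 - y1) / (x2 - x1)"
      define x3 where "x3 = (s^2 - 5) / 4 - x1 - x2"
      have y2: "y2 = y1 + s * (x2 - x1)" using 1 by (simp add: s_def)
      have x3: "4 * x3 = s^2 - 5 - 4 * x1 - 4 * x2" by (simp add: x3_def)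
      have y2': "- y2 = - y1 + (- s) * (x2 - x1)" using y2 by simp
      have x3': "4 * x3 = (- s)^2 - 5 - 4 * x1 - 4 * x2" using x3 by simp
      have w: "wcurve x2 (- y1 + (- s) * (x2 - x1))" using Q(2) unfolding y2'[symmetric] by simp
      have w': "wcurve x1 (- y1)" using P by simp
      have "third_point (neg P) (neg Q) = pt x3 (- y1 + (- s) * (x3 - x1))"
        unfolding negs y2' by (rule third_point_eqI[OF chord(1)[OF w' w 1 x3']])
      moreover have "third_point P Q = pt x3 (y1 + s * (x3 - x1))"
        unfolding P(1) Q(1) y2 by (rule third_point_eqI[OF chord(1)[OF P(2) Q(2)[unfolded y2] 1 x3]])
      ultimately show ?thesis
        using third_point_pinf_pt[OF chord(2)[OF P(2) Q(2)[unfolded y2] 1 x3]] by simp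
    next
      case 2
      then show ?thesis using P Q negs third_point_vertical[of x1 y1] third_point_vertical[of x1 "- y1"]
        by (simp add: third_point_pinf)
    next
      case 3
      define s where "s = (12 * x1^2 + 10 * x1 - 8) / (2 * y1)"
      define x3 where "x3 = (s^2 - 5) / 4 - 2 * x1"
      have s: "2 * y1 * s = 12 * x1^2 + 10 * x1 - 8" "2 * (- y1) * (- s) = 12 * x1^2 + 10 * x1 - 8"
        using 3 by (simp_all add: s_def)
      have x3: "4 * x3 = s^2 - 5 - 8 * x1" "4 * x3 = (- s)^2 - 5 - 8 * x1" by (simp_all add: x3_def)
      have w': "wcurve x1 (- y1)" using P by simp
      have "third_point (neg P) (neg Q) = pt x3 (- y1 + (- s) * (x3 - x1))"
        unfolding negs 3 by (rule third_point_eqI[OF tangent(1)[OF w' s(2) x3(2)]])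
      moreover have "third_point P Q = pt x3 (y1 + s * (x3 - x1))"
        unfolding P(1) Q(1) 3 by (rule third_point_eqI[OF tangent(1)[OF P(2) s(1) x3(1)]])
      ultimately show ?thesis
        using third_point_pinf_pt[OF tangent(2)[OF P(2) s(1) x3(1)]] by simp
    qed
  qed
qed

lemma add_commute: "add P Q = add Q P"
  by (simp add: third_point_commute)

lemma add_pinf: "on_curve P \<Longrightarrow> add pinf P = P"
  by (rule neg_neg)

lemma neg_add: "on_curve P \<Longrightarrow> on_curve Q \<Longrightarrow> neg (add P Q) = add (neg P) (neg Q)"
  by (simp add: third_point_neg)

text \<open>By \<open>third_point_neg\<close> the left side is the third point of
  \<open>third_point P Q\<close> and \<open>Q\<close>, which is \<open>P\<close>.\<close>

lemma add_neg_cancel: "on_curve P \<Longrightarrow> on_curve Q \<Longrightarrow> add (add P Q) (neg Q) = P"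
  by (metis neg_neg on_curve_third_point third_point_cancel third_point_commute third_point_neg)

lemma add_neg_cancel': "on_curve P \<Longrightarrow> on_curve Q \<Longrightarrow> add (add P (neg Q)) Q = P"
  by (metis add_neg_cancel neg_neg on_curve_neg)

lemma add_neg: "on_curve P \<Longrightarrow> add P (neg P) = pinf"
  by (metis add_neg_cancel add_pinf on_curve_pinf)

text \<open>The coordinates are relative to \<open>A = (x, y)\<close> and its tangent of slope \<open>m\<close>: the second
  point is \<open>B = A + (kt, (m + t)kt)\<close>, which makes all chords involved polynomial in \<open>k\<close>, \<open>t\<close>
  and \<open>m\<close>; for instance the chord through \<open>A + A\<close> and \<open>B\<close> has slope \<open>4k - m\<close>.\<close>

lemma alternative_generic:
  fixes x y m k t :: rat
  assumes A: "wcurve x y" and m: "2 * y * m = 12 * x^2 + 10 * x - 8" and "y \<noteq> 0"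
    and B: "wcurve (x + k * t) (y + (m + t) * (k * t))" and "k * t \<noteq> 0"
    and z: "4 * z = m^2 - 5 - 8 * x" "z \<noteq> x + k * t"
  shows "add (pt x y) (add (pt x y) (pt (x + k * t) (y + (m + t) * (k * t))))
    = add (add (pt x y) (pt x y)) (pt (x + k * t) (y + (m + t) * (k * t)))"
proof -
  \<comment> \<open>The hypothesis on \<open>z\<close> makes \<open>a2\<close> equal to 4(x - z).
    The point A + B has x-coordinate x + X, and m + u is the slope of the chord through A and A +
    B.\<close>
  define a2 where "a2 = 12 * x + 5 - m^2"
  define X where "X = - y / (2 * k)"
  define u where "u = 4 * k - 2 * m - t"
  let ?A = "pt x y" and ?B = "pt (x + k * t) (y + (m + t) * (k * t))"
  have nz: "k \<noteq> 0" "t \<noteq> 0" using \<open>k * t \<noteq> 0\<close> by auto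
  \<comment> \<open>Difference of the curve equations of A and B. As \<open>m\<close> is the tangent
    slope at A, the linear part shrinks to 2ykt^2, so nonzero factors can be cancelled.\<close>
  have "t * k * (k * t^2 + 2 * m * k * t + 2 * y) = t * k * (4 * k^2 * t + a2 * k)"
    using A B m unfolding wcurve_def a2_def by algebra
  then have curve: "k * t^2 + 2 * m * k * t + 2 * y = 4 * k^2 * t + a2 * k" using nz by simp
  have X: "2 * k * X = - y" using nz by (simp add: X_def)
  then have "X \<noteq> 0" using \<open>y \<noteq> 0\<close> by auto
  have "k * (4 * (x + X)) = k * ((m + t)^2 - 5 - 4 * x - 4 * (x + k * t))"
    using curve X unfolding a2_def by algebra
  then have x3: "4 * (x + X) = (m + t)^2 - 5 - 4 * x - 4 * (x + k * t)" using nz by simp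
  have B': "y + (m + t) * (k * t) = y + (m + t) * (x + k * t - x)" by simp
  have AB: "third_point ?A ?B = pt (x + X) (y + (m + t) * X)"
    "wcurve (x + X) (y + (m + t) * X)"
    using third_point_eqI[OF chord(1)[OF A B[unfolded B'] _ x3]] chord(2)[OF A B[unfolded B'] _ x3] nz
    by simp_all
  then have addAB: "add ?A ?B = pt (x + X) (- (y + (m + t) * X))" by (simp add: third_point_pinf_pt)
  have y3: "- (y + (m + t) * X) = y + (m + u) * (x + X - x)"
    using X unfolding u_def by algebra
  have w3: "wcurve (x + X) (y + (m + u) * (x + X - x))" using AB(2) unfolding y3[symmetric] wcurve_minus .
  have "4 * (x + u * k) = (m + u)^2 - 5 - 4 * x - 4 * (x + X)"
    using x3 unfolding u_def by algebra
  from third_point_eqI[OF chord(1)[OF A w3 _ this]] \<open>X \<noteq> 0\<close>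
  have AAB: "third_point ?A (add ?A ?B) = pt (x + u * k) (y + (m + u) * (u * k))"
    unfolding addAB y3 by simp
  define v where "v = - (y + m * (z - x))"
  have v: "- v = y + m * (z - x)" by (simp add: v_def)
  have AA: "third_point ?A ?A = pt z (- v)" "wcurve z (- v)"
    unfolding v by (intro third_point_eqI tangent A m z)+
  then have addAA: "add ?A ?A = pt z v" and wv: "wcurve z v" by (simp_all add: third_point_pinf_pt)
  have yB: "y + (m + t) * (k * t) = v + (4 * k - m) * (x + k * t - z)"
    using curve z(1) unfolding v_def a2_def by algebra
  have "4 * (x + u * k) = (4 * k - m)^2 - 5 - 4 * z - 4 * (x + k * t)"
    using z(1) unfolding u_def by algebra
  from third_point_eqI[OF chord(1)[OF wv B[unfolded yB] z(2) this]]
  have "third_point (add ?A ?A) ?B = pt (x + u * k) (v + (4 * k - m) * (x + u * k - z))"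
    unfolding addAA yB .
  moreover have "v + (4 * k - m) * (x + u * k - z) = y + (m + u) * (u * k)"
    using yB unfolding u_def by algebra
  ultimately show ?thesis using AAB by simp
qed

section \<open>Periodic points of the duplication map\<close>

definition two_integral :: "rat \<Rightarrow> bool"
  where "two_integral r \<longleftrightarrow> (\<exists>p q. odd q \<and> r = of_int p / of_int q)"

text \<open>The units of the localisation of the integers at 2, whose elements are the
  \<open>two_integral\<close> rationals: 2-adic valuation 0. Fractions need not be reduced, which
  makes closure under products direct.\<close>

definition two_unit :: "rat \<Rightarrow> bool"
  where "two_unit r \<longleftrightarrow> (\<exists>p q. odd p \<and> odd q \<and> r = of_int p / of_int q)"

lemma odd_imp_nz: "odd (q::int) \<Longrightarrow> rat_of_int q \<noteq> 0"
  by auto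

lemma two_integral_mult: "two_integral r \<Longrightarrow> two_integral s \<Longrightarrow> two_integral (r * s)"
  unfolding two_integral_def
proof clarify
  fix p q p' q' :: int assume "odd q" "odd q'"
  then show "\<exists>p'' q''. odd q'' \<and> rat_of_int p / rat_of_int q * (rat_of_int p' / rat_of_int q')
      = rat_of_int p'' / rat_of_int q''"
    by (intro exI[of _ "p * p'"] exI[of _ "q * q'"]) auto
qed

lemma two_unit_mult: "two_unit r \<Longrightarrow> two_unit s \<Longrightarrow> two_unit (r * s)"
  unfolding two_unit_def
proof clarify
  fix p q p' q' :: int assume "odd q" "odd q'" "odd p" "odd p'"
  then show "\<exists>p'' q''. odd p'' \<and> odd q'' \<and> rat_of_int p / rat_of_int q * (rat_of_int p' / rat_of_int q')
      = rat_of_int p'' / rat_of_int q''"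
    by (intro exI[of _ "p * p'"] exI[of _ "q * q'"]) auto
qed

lemma two_unit_divide: "two_unit r \<Longrightarrow> two_unit s \<Longrightarrow> two_unit (r / s)"
  unfolding two_unit_def
proof clarify
  fix p q p' q' :: int assume "odd q" "odd q'" "odd p" "odd p'"
  then show "\<exists>p'' q''. odd p'' \<and> odd q'' \<and> rat_of_int p / rat_of_int q / (rat_of_int p' / rat_of_int q')
      = rat_of_int p'' / rat_of_int q''"
    by (intro exI[of _ "p * q'"] exI[of _ "q * p'"]) auto
qed

lemma two_integral_add: "two_integral r \<Longrightarrow> two_integral s \<Longrightarrow> two_integral (r + s)"
  unfolding two_integral_def
proof clarify
  fix p q p' q' :: int assume *: "odd q" "odd q'"
  then have "rat_of_int p / rat_of_int q + rat_of_int p' / rat_of_int q' = of_int (p * q' + p' * q) / of_int (q * q')"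
    unfolding of_int_mult of_int_add by (intro add_frac_eq odd_imp_nz)
  then show "\<exists>p'' q''. odd q'' \<and> rat_of_int p / rat_of_int q + (rat_of_int p' / rat_of_int q')
      = rat_of_int p'' / rat_of_int q''"
    by (intro exI[of _ "p * q' + p' * q"] exI[of _ "q * q'"] conjI) (use * in simp)
qed

lemma two_integral_of_int [simp]: "two_integral (of_int p)"
  and two_integral_numeral [simp]: "two_integral (numeral k)"
  and two_integral_1 [simp]: "two_integral 1"
  unfolding two_integral_def
proof -
  show "\<exists>p' q. odd q \<and> rat_of_int p = rat_of_int p' / rat_of_int q" by (intro exI[of _ p] exI[of _ 1]) auto
  show "\<exists>p' q. odd q \<and> numeral k = rat_of_int p' / rat_of_int q" by (intro exI[of _ "numeral k"] exI[of _ 1]) auto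
  show "\<exists>p' q. odd q \<and> 1 = rat_of_int p' / rat_of_int q" by (intro exI[of _ 1] exI[of _ 1]) auto
qed

lemma two_integral_minus: "two_integral r \<Longrightarrow> two_integral (- r)"
  using two_integral_mult[of "of_int (-1)" r, OF two_integral_of_int]
  by simp

lemma two_integral_diff: "two_integral r \<Longrightarrow> two_integral s \<Longrightarrow> two_integral (r - s)"
  using two_integral_add[of r "-s"] two_integral_minus
  by auto

lemma two_integral_power: "two_integral r \<Longrightarrow> two_integral (r ^ n)"
  by (induction n) (auto intro: two_integral_mult)

lemma two_unit_imp_two_integral: "two_unit r \<Longrightarrow> two_integral r"
  unfolding two_unit_def two_integral_def
  by blast

lemma two_unit_nonzero: "two_unit r \<Longrightarrow> r \<noteq> 0"
  unfolding two_unit_def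
  by auto

lemma two_unit_1 [simp]: "two_unit 1"
  unfolding two_unit_def
  by (intro exI[of _ 1]) auto

lemma two_integral_cases:
  assumes "two_integral r"
  obtains (odd) "two_unit r" | (even) s where "two_integral s" "r = 2 * s"
proof -
  obtain p q where *: "odd q" "r = of_int p / of_int q" using assms unfolding two_integral_def by blast
  show ?thesis
  proof (cases "odd p")
    case True then show ?thesis using * odd unfolding two_unit_def by blast
  next
    case False
    then obtain p' where "p = 2 * p'" by auto
    then show ?thesis using * even[of "of_int p' / of_int q"] unfolding two_integral_def by auto
  qed
qed

text \<open>The residue field at 2 has two elements, so the units are the elements congruent to 1
  modulo 2.\<close>

lemma two_unit_iff: "two_unit r \<longleftrightarrow> (\<exists>s. two_integral s \<and> r = 1 + 2 * s)"
proof
  assume "two_unit r"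
  then obtain p q where *: "odd p" "odd q" "r = of_int p / of_int q" unfolding two_unit_def by blast
  then obtain k where k: "p - q = 2 * k" by (metis odd_even_add even_diff dvd_def)
  have "r = 1 + 2 * (of_int k / of_int q)"
  proof -
    have "q \<noteq> 0" using * by auto
    have "rat_of_int p = of_int q + 2 * of_int k"
      using k by (metis add_diff_cancel_left' diff_add_cancel of_int_add of_int_mult of_int_numeral add.commute)
    then show ?thesis using * \<open>q \<noteq> 0\<close> by (simp add: field_simps)
  qed
  then show "\<exists>s. two_integral s \<and> r = 1 + 2 * s" using * unfolding two_integral_def by blast
next
  assume "\<exists>s. two_integral s \<and> r = 1 + 2 * s"
  then obtain p q where *: "odd q" "r = 1 + 2 * (of_int p / of_int q)" unfolding two_integral_def by blast
  then have "r = of_int (q + 2 * p) / of_int q" "odd (q + 2 * p)" using odd_imp_nz[OF *(1)] by (auto simp: add_divide_distrib)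
  then show "two_unit r" using * unfolding two_unit_def by blast
qed

lemma two_unit_add_even: "two_unit r \<Longrightarrow> two_integral s \<Longrightarrow> two_unit (r + 2 * s)"
  unfolding two_unit_iff by (metis add.assoc distrib_left two_integral_add)

lemma not_two_unit_even: "two_integral s \<Longrightarrow> \<not> two_unit (2 * s)"
proof
  assume "two_integral s" "two_unit (2 * s)"
  then obtain t where t: "two_integral t" "2 * s = 1 + 2 * t" unfolding two_unit_iff by blast
  \<comment> \<open>An even unit would make 1/2 integral at 2.\<close>
  then have "two_integral (s - t)" "s - t = 1 / 2" using two_integral_diff \<open>two_integral s\<close> by auto
  then obtain p q where *: "odd q" "1 / 2 = rat_of_int p / of_int q" unfolding two_integral_def by auto
  then have "rat_of_int q = of_int (2 * p)" by (auto simp: field_simps)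
  then have "q = 2 * p" unfolding of_int_eq_iff .
  then show False using * by simp
qed

lemma rat_2_cases:
  assumes "x \<noteq> (0::rat)"
  obtains (int) "two_integral x" | (frac) u k where "two_unit u" "k > 0" "x = u / 2 ^ k"
proof -
  obtain p q where pq: "x = of_int p / of_int q" "q > 0" "coprime p q"
    by (metis quotient_of_div quotient_of_coprime quotient_of_denom_pos surj_pair)
  show ?thesis
  proof (cases "odd q")
    case True then show ?thesis using pq int unfolding two_integral_def by blast
  next
    case False
    then have "odd p" using pq(3) by (meson coprime_common_divisor odd_one)
    obtain r where r: "q = 2 ^ multiplicity 2 q * r" "odd r"
      using multiplicity_decompose'[of q 2] pq(2) by auto
    define k where "k = multiplicity 2 q"
    note r = r[folded k_def]
    have "k > 0" using r False by (cases k) auto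
    then show ?thesis using frac[of "of_int p / of_int r" k] r pq \<open>odd p\<close> unfolding two_unit_def by auto
  qed
qed

text \<open>The x-coordinate of P + P in terms of that of P, see \<open>add_self\<close>; the
  denominator is y^2. At x = 0, where P + P = O, division by zero yields 0, so only nonzero x are
  followed.\<close>

definition dbl :: "rat \<Rightarrow> rat"
  where "dbl x = (x^2 + 2)^2 / (x * (4 * x^2 + 5 * x - 8))"

section \<open>Polynomials without rational roots, by reduction modulo 5\<close>

lemma rat_coprime_fraction:
  obtains p q :: int where "x = rat_of_int p / rat_of_int q" "q > 0" "coprime p q"
  by (metis quotient_of_div quotient_of_coprime quotient_of_denom_pos surj_pair)

lemma mod_5_cases: "(p::int) mod 5 \<in> {0, 1, 2, 3, 4}"
  by auto

text \<open>3 is a non-residue modulo 5. The second form is 3A^2 + 3AB + B^2 at A = a^2, B = b^2,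
  and its discriminant -3 is a non-residue too.\<close>

lemma forms_mod_5:
  fixes a b :: int
  assumes "a \<in> {0, 1, 2, 3, 4}" "b \<in> {0, 1, 2, 3, 4}"
  shows "a^2 mod 5 = (3 * b^2) mod 5 \<Longrightarrow> a = 0 \<and> b = 0"
    and "(3 * a^4 + 3 * a^2 * b^2 + b^4) mod 5 = 0 \<Longrightarrow> a = 0 \<and> b = 0"
  using assms by auto

text \<open>A rational root would make the discriminant 153 a rational square, but 153 is 3 modulo
  5. Hence D is the only rational affine point with y = 0.\<close>

lemma quadratic_nonzero: "4 * x^2 + 5 * x - 8 \<noteq> (0::rat)"
proof
  assume *: "4 * x^2 + 5 * x - 8 = 0"
  obtain p q where pq: "8 * x + 5 = rat_of_int p / of_int q" "q > 0" "coprime p q"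
    by (rule rat_coprime_fraction)
  have 153: "(8 * x + 5)^2 = 153" using * by algebra
  have "rat_of_int p = (8 * x + 5) * of_int q" using pq(1,2) by simp
  then have "rat_of_int p^2 = 153 * of_int q^2" by (simp only: power_mult_distrib 153)
  then have "rat_of_int (p^2) = of_int (153 * q^2)" by simp
  then have "p^2 = 153 * q^2" unfolding of_int_eq_iff .
  moreover have "[p^2 = (p mod 5)^2] (mod 5)" "[153 * q^2 = 3 * (q mod 5)^2] (mod 5)"
    by (intro cong_mult cong_pow; simp add: cong_def)+
  ultimately have "(p mod 5)^2 mod 5 = (3 * (q mod 5)^2) mod 5" by (simp add: cong_def)
  then have "5 dvd p \<and> 5 dvd q"
    unfolding dvd_eq_mod_eq_0 by (rule forms_mod_5(1)[OF mod_5_cases mod_5_cases])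
  then have "is_unit (5::int)" using pq(3) coprime_common_divisor by blast
  then show False by simp
qed

text \<open>The quartic arises by clearing denominators in \<open>dbl x = x\<close>. Modulo 5 its
  homogenisation is the second form of \<open>forms_mod_5\<close>, so numerator and denominator in
  lowest terms would share the factor 5.\<close>

lemma quartic_nonzero: "3 * x^4 + 5 * x^3 - 12 * x^2 - 4 \<noteq> (0::rat)"
proof
  assume *: "3 * x^4 + 5 * x^3 - 12 * x^2 - 4 = 0"
  obtain p q where pq: "x = rat_of_int p / of_int q" "q > 0" "coprime p q"
    by (rule rat_coprime_fraction)
  have p: "rat_of_int p = x * of_int q" using pq by simp
  then have "3 * rat_of_int p^4 + 5 * of_int p^3 * of_int q - 12 * of_int p^2 * of_int q^2 - 4 * of_int q^4
      = (3 * x^4 + 5 * x^3 - 12 * x^2 - 4) * of_int q^4"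
    unfolding p by algebra
  then have "rat_of_int (3 * p^4 + 5 * p^3 * q - 12 * p^2 * q^2 - 4 * q^4) = of_int 0"
    unfolding * by simp
  then have "3 * p^4 + 5 * p^3 * q - 12 * p^2 * q^2 - 4 * q^4 = 0" unfolding of_int_eq_iff .
  then have "3 * p^4 + 3 * p^2 * q^2 + q^4 = 5 * (q^4 + 3 * p^2 * q^2 - p^3 * q)" by algebra
  then have "(3 * p^4 + 3 * p^2 * q^2 + q^4) mod 5 = 0" by (metis mod_mult_self1_is_0)
  moreover have "[3 * p^4 + 3 * p^2 * q^2 + q^4
      = 3 * (p mod 5)^4 + 3 * (p mod 5)^2 * (q mod 5)^2 + (q mod 5)^4] (mod 5)"
    by (intro cong_add cong_mult cong_pow; simp add: cong_def)
  ultimately have "(3 * (p mod 5)^4 + 3 * (p mod 5)^2 * (q mod 5)^2 + (q mod 5)^4) mod 5 = 0"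
    by (simp add: cong_def)
  then have "5 dvd p \<and> 5 dvd q"
    unfolding dvd_eq_mod_eq_0 by (rule forms_mod_5(2)[OF mod_5_cases mod_5_cases])
  then have "is_unit (5::int)" using pq(3) coprime_common_divisor by blast
  then show False by simp
qed

lemma dbl_nonzero: "x \<noteq> 0 \<Longrightarrow> dbl x \<noteq> 0"
proof -
  have "x^2 + 2 \<noteq> 0" using zero_le_power2[of x] by linarith
  then show "x \<noteq> 0 \<Longrightarrow> dbl x \<noteq> 0" using quadratic_nonzero[of x] by (simp add: dbl_def)
qed

section \<open>Duplication and the power of 2\<close>

lemmas two_integral_intros = two_integral_add two_integral_diff two_integral_mult two_integral_power two_integral_numeral two_integral_1

lemma two_unit_5: "two_unit 5"
proof -
  have "rat_of_int 5 / of_int 1 = 5" by simp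
  then show ?thesis unfolding two_unit_def by (metis odd_numeral odd_one)
qed

lemma two_unit_power: "two_unit r \<Longrightarrow> two_unit (r ^ n)"
  by (induction n) (auto intro: two_unit_mult)

lemma two_integral_decompose:
  assumes "two_integral r" "r \<noteq> 0"
  obtains j u where "two_unit u" "r = 2^j * u"
proof -
  obtain p q where *: "odd q" "r = of_int p / of_int q" using assms unfolding two_integral_def by blast
  then have "p \<noteq> 0" using assms by auto
  then obtain p' where "p = 2 ^ multiplicity 2 p * p'" "odd p'" using multiplicity_decompose'[of p 2] by auto
  moreover define j where "j = multiplicity 2 p"
  ultimately have "p = 2 ^ j * p'" "odd p'" by simp_all
  then have "r = 2^j * (of_int p' / of_int q)" "two_unit (of_int p' / of_int q)" using * by (auto simp: two_unit_def)
  then show ?thesis using that by blast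
qed

lemma two_unit_frac_unique: "two_unit u \<Longrightarrow> two_unit v \<Longrightarrow> u / 2^k = v / 2^l \<Longrightarrow> k \<le> l"
proof (rule ccontr)
  assume *: "two_unit u" "two_unit v" "u / 2^k = v / 2^l" "\<not> k \<le> l"
  define d where "d = k - l - 1"
  have "k = Suc (l + d)" using * by (simp add: d_def)
  then have "u = 2 * (2^d * v)" using *(3) by (simp add: field_simps power_add)
  moreover have "two_integral (2^d * v)" by (intro two_integral_intros two_unit_imp_two_integral *)
  ultimately show False using not_two_unit_even * by blast
qed

text \<open>For a 2-adic unit x both x^2 + 2 and 4x^2 + 5x - 8 are units.\<close>

lemma dbl_odd: "two_unit x \<Longrightarrow> two_unit (dbl x)"
proof -
  assume x: "two_unit x"
  have "two_unit (x^2 + 2 * 1)" "two_unit (5 * x + 2 * (2 * x^2 - 4))"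
    by (intro two_unit_add_even two_unit_power two_unit_mult x two_integral_intros two_unit_imp_two_integral[OF x] two_unit_5)+
  then show ?thesis unfolding dbl_def
    by (intro two_unit_divide two_unit_power two_unit_mult x) (simp_all add: algebra_simps)
qed

text \<open>The numerator has exponent 4k, the factors of the denominator have k and 2k, and at
  least one further factor 2 comes out of the denominator.\<close>

lemma dbl_frac:
  assumes "two_unit u" "k > 0"
  obtains v l where "two_unit v" "l > k" "dbl (u / 2^k) = v / 2^l"
proof -
  obtain k' where k: "k = Suc k'" using assms by (cases k) auto
  \<comment> \<open>The quadratic factor is 2w/4^k; taking out this 2 uses k > 0. Since
    \<open>w\<close> may itself be even, a further exponent \<open>j\<close> appears.\<close>
  define w where "w = 2 * u^2 + 5 * u * 2^k' - 4 * 4^k"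
  have 4: "(4::rat)^k = 2^k * 2^k" by (simp flip: power_mult_distrib)
  have eq: "4 * (u / 2^k)^2 + 5 * (u / 2^k) - 8 = 2 * w / (2^k * 2^k)"
    unfolding w_def 4 by (simp add: field_simps power2_eq_square k)
  have "two_integral w" unfolding w_def by (intro two_integral_intros two_unit_imp_two_integral assms)
  moreover have "w \<noteq> 0" using quadratic_nonzero[of "u / 2^k"] unfolding eq by auto
  ultimately obtain j z where z: "two_unit z" "w = 2^j * z" by (rule two_integral_decompose)
  have "two_unit (u^2 + 2 * 4^k)" by (intro two_unit_add_even two_unit_power assms two_integral_intros)
  then have o: "two_unit ((u^2 + 2 * 4^k)^2 / (u * z))" by (intro two_unit_divide two_unit_power two_unit_mult assms z)
  have "(u / 2^k)^2 + 2 = (u^2 + 2 * 4^k) / (2^k * 2^k)"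
    unfolding 4 by (simp add: field_simps power2_eq_square)
  then have "dbl (u / 2^k) = ((u^2 + 2 * 4^k) / (2^k * 2^k))^2 / (u / 2^k * (2 * (2^j * z) / (2^k * 2^k)))"
    unfolding dbl_def eq z by simp
  also have "\<dots> = ((u^2 + 2 * 4^k)^2 / (u * z)) / 2^(k + 1 + j)"
    using two_unit_nonzero[OF z(1)] two_unit_nonzero[OF assms(1)]
    by (simp add: field_simps power2_eq_square power_add)
  finally show ?thesis using o that[of "(u^2 + 2 * 4^k)^2 / (u * z)" "k + 1 + j"] by simp
qed

text \<open>2-adic valuation at most 0: units and fractions with even denominator together, a set
  closed under duplication.\<close>

definition odd_numerator :: "rat \<Rightarrow> bool" where "odd_numerator x \<longleftrightarrow> (\<exists>u k. two_unit u \<and> x = u / 2^k)"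

lemma odd_numerator_dbl: "odd_numerator x \<Longrightarrow> odd_numerator (dbl x)"
proof -
  assume "odd_numerator x"
  then obtain u k where u: "two_unit u" "x = u / 2^k" unfolding odd_numerator_def by blast
  show ?thesis
  proof (cases "k = 0")
    case True
    then show ?thesis using dbl_odd[OF u(1)] u unfolding odd_numerator_def by (intro exI[of _ "dbl u"] exI[of _ 0]) simp
  next
    case False
    then show ?thesis using dbl_frac[OF u(1), of k] u(2) unfolding odd_numerator_def by (metis gr0I)
  qed
qed

text \<open>After cancelling 4 the numerator (1 + 2z^2)^2 is a unit and the denominator is integral
  at 2.\<close>

lemma dbl_even:
  assumes "two_integral z" "z \<noteq> 0"
  shows "odd_numerator (dbl (2 * z))"
proof -
  have *: "4 * (2 * z)^2 + 5 * (2 * z) - 8 = 2 * (8 * z^2 + 5 * z - 4)"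
    "(2 * z)^2 + 2 = 2 * (1 + 2 * z^2)" by algebra+
  have nz: "8 * z^2 + 5 * z - 4 \<noteq> 0" using quadratic_nonzero[of "2 * z"] unfolding * by simp
  have "(2 * A)^2 / (2 * z * (2 * B)) = A^2 / (z * B)" for A B :: rat
    by (simp add: power2_eq_square)
  then have eq: "dbl (2 * z) = (1 + 2 * z^2)^2 / (z * (8 * z^2 + 5 * z - 4))"
    unfolding dbl_def * .
  have "two_integral (z * (8 * z^2 + 5 * z - 4))" by (intro two_integral_intros assms)
  then obtain j u where u: "two_unit u" "z * (8 * z^2 + 5 * z - 4) = 2^j * u"
    using two_integral_decompose assms nz by (metis mult_eq_0_iff)
  have "two_unit ((1 + 2 * z^2)^2 / u)"
    by (intro two_unit_divide two_unit_power two_unit_add_even u two_integral_intros assms two_unit_1)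
  then show ?thesis unfolding eq u(2) odd_numerator_def
    by (intro exI[of _ "(1 + 2 * z^2)^2 / u"] exI[of _ j]) (simp add: field_simps)
qed

text \<open>Cross-multiplying over unit denominators leaves 2G(x - y). The one odd coefficient
  stands with x + y, which is even for two units and is written 2s.\<close>

lemma dbl_contract:
  assumes x: "two_unit x" and y: "two_unit y"
  obtains w where "two_integral w" "dbl x - dbl y = 2 * w * (x - y)"
proof -
  obtain a b where ab: "two_integral a" "x = 1 + 2 * a" "two_integral b" "y = 1 + 2 * b"
    using x y unfolding two_unit_iff by blast
  define s where "s = 1 + a + b"
  have s: "two_integral s" "x + y = 2 * s" using ab by (auto simp: s_def intro!: two_integral_intros)
  have ix: "two_integral x" and iy: "two_integral y" using x y two_unit_imp_two_integral by auto
  define G where "G = 2 * x^3 * y^3 + 5 * x^2 * y^2 * s - 4 * x * y * (x^2 + x * y + y^2)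
     - 8 * x^2 * y^2 - 16 * x * y - 8 * (x^2 + x * y + y^2) - 20 * s + 16"
  have G: "two_integral G" unfolding G_def by (intro two_integral_intros ix iy s)
  define D where "D x = x * (4 * x^2 + 5 * x - 8)" for x :: rat
  have D: "two_unit (D z)" if "two_unit z" for z
  proof -
    have "two_unit (z * 5 + 2 * (2 * z^2 - 4))"
      by (intro two_unit_add_even two_unit_mult that two_integral_intros two_unit_imp_two_integral[OF that] two_unit_5)
    then show ?thesis unfolding D_def by (intro two_unit_mult that) (simp add: algebra_simps)
  qed
  have "(x^2 + 2)^2 * D y - (y^2 + 2)^2 * D x = 2 * G * (x - y)"
    using s(2) unfolding G_def D_def by algebra
  then have "dbl x - dbl y = 2 * (G / (D x * D y)) * (x - y)"
    unfolding dbl_def D_def[symmetric] using two_unit_nonzero[OF D[OF x]] two_unit_nonzero[OF D[OF y]]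
    by (simp add: field_simps)
  moreover have "two_integral (G / (D x * D y))"
    using two_integral_mult[OF G two_unit_imp_two_integral[OF two_unit_divide[OF two_unit_1 two_unit_mult[OF D[OF x] D[OF y]]]]] by simp
  ultimately show ?thesis using that by blast
qed

lemma dbl_not_periodic:
  assumes "x \<noteq> 0" "n > 0" "(dbl ^^ n) x = x"
  shows False
proof -
  have nev: "odd_numerator ((dbl ^^ m) y)" if "odd_numerator y" for m y using that by (induction m) (auto intro: odd_numerator_dbl)
  show False
  using assms(1) proof (cases rule: rat_2_cases)
    case (frac u k)
    \<comment> \<open>The exponent of 2 in the denominator rises at every step, so it cannot return
      to \<open>k\<close>.\<close>
    have "\<exists>v l. two_unit v \<and> l \<ge> k + m \<and> (dbl ^^ m) x = v / 2^l" for m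
    proof (induction m)
      case 0 then show ?case using frac by auto
    next
      case (Suc m)
      then obtain v l where v: "two_unit v" "l \<ge> k + m" "(dbl ^^ m) x = v / 2^l" by blast
      moreover from this have "l > 0" using frac by simp
      ultimately obtain v' l' where "two_unit v'" "l' > l" "dbl (v / 2^l) = v' / 2^l'" using dbl_frac by metis
      then show ?case using v by (intro exI[of _ v'] exI[of _ l']) auto
    qed
    from this[of n] obtain v l where v: "two_unit v" "l \<ge> k + n" "x = v / 2^l" using assms(3) by metis
    then have "l \<le> k" using two_unit_frac_unique[of v u l k] frac by simp
    then show False using v assms(2) by simp
  next
    case int
    then show False
    proof (cases rule: two_integral_cases)
      case (even z)
      obtain n' where n: "n = Suc n'" using assms(2) by (cases n) auto
      \<comment> \<open>From the first step on the orbit has odd numerators, yet it returns to the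
        even \<open>x\<close>.\<close>
      have "odd_numerator (dbl x)" using dbl_even even assms(1) by auto
      then have "odd_numerator x" using nev[of "dbl x" n'] assms(3) unfolding n funpow_Suc_right by simp
      then obtain u k where u: "two_unit u" "x = u / 2^k" unfolding odd_numerator_def by blast
      then have "u = 2 * (2^k * z)" using even by (simp add: field_simps)
      moreover have "two_integral (2^k * z)" by (intro two_integral_intros even)
      ultimately show False using not_two_unit_even u by blast
    next
      case odd
      have o: "two_unit ((dbl ^^ m) x)" for m using odd by (induction m) (auto intro: dbl_odd)
      \<comment> \<open>Iterated contraction: consecutive differences along the orbit gain a factor
        2 at each step.\<close>
      have "\<exists>w. two_integral w \<and> (dbl ^^ Suc m) x - (dbl ^^ m) x = 2^m * w * (dbl x - x)" for m
      proof (induction m)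
        case 0 show ?case by (intro exI[of _ 1]) simp
      next
        case (Suc m)
        then obtain w where w: "two_integral w" "(dbl ^^ Suc m) x - (dbl ^^ m) x = 2^m * w * (dbl x - x)" by blast
        obtain v where v: "two_integral v" "dbl ((dbl ^^ Suc m) x) - dbl ((dbl ^^ m) x) =
            2 * v * ((dbl ^^ Suc m) x - (dbl ^^ m) x)" using dbl_contract[OF o o] by blast
        show ?case using v(2) unfolding w(2)
          by (intro exI[of _ "v * w"]) (simp add: two_integral_mult v w algebra_simps)
      qed
      \<comment> \<open>For m = n the left side is \<open>dbl x - x\<close> again; if nonzero, it
        could be cancelled, leaving 2^n w = 1.\<close>
      from this[of n] obtain w where w: "two_integral w" "dbl x - x = 2^n * w * (dbl x - x)"
        using assms(3) by auto
      have "dbl x = x"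
      proof (rule ccontr)
        assume "dbl x \<noteq> x"
        then have 1: "2^n * w = 1" using w(2) by auto
        obtain n' where n: "n = Suc n'" using assms(2) by (cases n) auto
        have "2 * (2^n' * w) = 1" using 1 n by simp
        moreover have "two_integral (2^n' * w)" by (intro two_integral_intros w)
        ultimately show False using not_two_unit_even two_unit_1 by metis
      qed
      then have "(x^2 + 2)^2 = x * (x * (4 * x^2 + 5 * x - 8))"
        using assms(1) quadratic_nonzero[of x] by (simp add: dbl_def divide_eq_eq)
      then have "3 * x^4 + 5 * x^3 - 12 * x^2 - 4 = 0" by algebra
      then show False using quartic_nonzero by blast
    qed
  qed
qed

section \<open>Torsion points\<close>

lemma wcurve_y_nonzero: "wcurve x y \<Longrightarrow> x \<noteq> 0 \<Longrightarrow> y \<noteq> 0"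
proof
  assume "wcurve x y" "x \<noteq> 0" "y = 0"
  then have "x * (4 * x^2 + 5 * x - 8) = 0" unfolding wcurve_def by algebra
  then show False using quadratic_nonzero[of x] \<open>x \<noteq> 0\<close> by simp
qed

lemma add_self:
  assumes "wcurve x y" "x \<noteq> 0"
  shows "\<exists>y'. add (pt x y) (pt x y) = pt (dbl x) y' \<and> wcurve (dbl x) y'"
proof -
  define s where "s = (12 * x^2 + 10 * x - 8) / (2 * y)"
  have y: "y \<noteq> 0" using assms by (rule wcurve_y_nonzero)
  then have s: "2 * y * s = 12 * x^2 + 10 * x - 8" by (simp add: s_def)
  have yy: "y^2 = x * (4 * x^2 + 5 * x - 8)" using assms(1) unfolding wcurve_def by algebra
  have "y^2 * (s^2 - 5 - 8 * x) = 4 * (x^2 + 2)^2"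
    using s assms(1) unfolding wcurve_def by algebra
  then have dbl: "4 * dbl x = s^2 - 5 - 8 * x"
    using y unfolding dbl_def yy[symmetric] by (simp add: field_simps)
  have "add (pt x y) (pt x y) = pt (dbl x) (- (y + s * (dbl x - x)))"
    using third_point_eqI[OF tangent(1)[OF assms(1) s dbl]] tangent(2)[OF assms(1) s dbl]
    by (simp only: third_point_pinf_pt)
  then show ?thesis using tangent(2)[OF assms(1) s dbl] wcurve_minus by blast
qed

text \<open>Otherwise P + P = -P and the x-coordinate is a fixed point of \<open>dbl\<close>; at (0,
  0) the tangent is vertical and its third point is O.\<close>

lemma no_three_torsion:
  assumes "wcurve x y"
  shows "third_point (pt x y) (pt x y) \<noteq> pt x y"
proof
  assume *: "third_point (pt x y) (pt x y) = pt x y"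
  have "x \<noteq> 0"
  proof
    assume "x = 0"
    then have "y = - y" using assms by (simp add: wcurve_def)
    then show False using third_point_vertical[OF assms] * by simp
  qed
  then obtain y' where "neg (pt x y) = pt (dbl x) y'" using add_self[OF assms] * by metis
  then have "dbl x = x" using third_point_pinf_pt[OF assms] by simp
  then show False using dbl_not_periodic[of x 1] \<open>x \<noteq> 0\<close> by simp
qed

text \<open>If A = -A, or B is O, A, -A or -(A + A), commutativity and the inverse property suffice;
  generic points are handled by explicit chords. \<open>ne\<close> gathers everything but
  \<open>B = add A A\<close>.\<close>

lemma alternative:
  assumes A: "on_curve A" and B: "on_curve B"
  shows "add A (add A B) = add (add A A) B"
  using A
proof (cases rule: on_curve_cases)
  case 1
  then show ?thesis using B by (simp add: add_pinf on_curve_intros third_point_pinf)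
next
  case A': (2 x y)
  have opposite: "add A (add A (third_point A A)) = add (add A A) (third_point A A)"
    using A by (simp add: add_neg third_point_cancel on_curve_intros third_point_commute[of "add A A"] )
  have ne: "add A (add A B) = add (add A A) B"
    if B: "on_curve B" and "B \<noteq> add A A" for B
    using B
  proof (cases rule: on_curve_cases)
    case 1
    have "add P pinf = P" if "on_curve P" for P using add_pinf[OF that] by (simp add: add_commute)
    then show ?thesis using A 1 on_curve_add by simp
  next
    case B': (2 x2 y2)
    consider "A = neg A" | "B = A" | "B = neg A" | "B = third_point A A"
      | "y \<noteq> 0" "x2 \<noteq> x" "B \<noteq> third_point A A"
      using A' B' third_point_pinf_pt wcurve_same_x by (metis minus_zero)
    then show ?thesis
    proof cases
      case 1
      then have "add A A = pinf" using add_neg[OF A] by simp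
      moreover have "add A (add A B) = B"
        using add_neg_cancel[OF B A] 1 by (metis add_commute)
      ultimately show ?thesis using add_pinf[OF B] by simp
    next
      case 2
      show ?thesis unfolding 2 by (rule add_commute)
    next
      case 3
      have "add A pinf = A" using add_pinf[OF A] by (metis add_commute)
      then show ?thesis unfolding 3 using add_neg[OF A] add_neg_cancel[OF A A] by simp
    next
      case 4
      then show ?thesis using opposite by simp
    next
      case 5
      define m where "m = (12 * x^2 + 10 * x - 8) / (2 * y)"
      define z where "z = (m^2 - 5) / 4 - 2 * x"
      define t where "t = (y2 - y) / (x2 - x) - m"
      have m: "2 * y * m = 12 * x^2 + 10 * x - 8" using 5 by (simp add: m_def)
      have z: "4 * z = m^2 - 5 - 8 * x" by (simp add: z_def)
      have AA: "third_point A A = pt z (y + m * (z - x))" "wcurve z (y + m * (z - x))"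
        unfolding A'(1) by (intro third_point_eqI tangent A' m z)+
      have "(m + t) * (x2 - x) = y2 - y" using 5 by (simp add: t_def)
      then have y2: "y2 = y + (m + t) * (x2 - x)" by simp
      \<comment> \<open>Equality would make B either A + A or its negative, both excluded
        here.\<close>
      have "x2 \<noteq> z"
        using wcurve_same_x[OF AA(2), of y2] B' AA 5 \<open>B \<noteq> add A A\<close> third_point_pinf_pt by auto
      \<comment> \<open>Otherwise B lies on the tangent at A, whose intersections with the curve
        have x-coordinates x (twice) and z.\<close>
      have "t \<noteq> 0"
      proof
        assume "t = 0"
        then have "y2 = y + m * (x2 - x)" using y2 by simp
        then have "(x2 - x)^2 * (4 * x2 - 4 * z) = 0"
          using A'(2) B'(2) m z unfolding wcurve_def by algebra
        then show False using 5 \<open>x2 \<noteq> z\<close> by simp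
      qed
      define k where "k = (x2 - x) / t"
      have x2: "x2 = x + k * t" using \<open>t \<noteq> 0\<close> by (simp add: k_def)
      then have y2': "y2 = y + (m + t) * (k * t)" using y2 by simp
      show ?thesis unfolding A'(1) B'(1) y2' unfolding x2
        by (rule alternative_generic[OF A'(2) m 5(1) _ _ z])
          (use B'(2) x2 y2' 5 \<open>x2 \<noteq> z\<close> in auto)
    qed
  qed
  show ?thesis
  proof (cases "B = add A A")
    case True
    \<comment> \<open>The chord through \<open>A + A\<close> and \<open>B\<close> degenerates to a tangent; the generic case for \<open>A\<close> and
      \<open>C = -4A\<close> still gives the claim, as \<open>C \<noteq> 2A\<close> because there is no 3-torsion.\<close>
    define C where "C = neg (add B B)"
    have C: "on_curve C" unfolding C_def using B by (intro on_curve_intros)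
    show ?thesis
    proof (cases "B = pinf")
      case True
      then show ?thesis using ne[OF A] \<open>B = add A A\<close> opposite
        by (metis A B add_neg_cancel add_pinf third_point_commute ne on_curve_add third_point_pinf_pt neg_neg)
    next
      case False
      have "C \<noteq> B"
      proof
        assume "C = B"
        then have "third_point B B = B" unfolding C_def using neg_neg B on_curve_intros by metis
        then show False using False B no_three_torsion by (metis on_curve_cases)
      qed
      then have "add A (add A C) = add B C" using ne[OF C] True by simp
      also have "add B C = add C (neg (neg B))" using neg_neg[OF B] by (simp add: third_point_commute)
      also have "\<dots> = neg (add (add B B) (neg B))"
        unfolding C_def by (rule neg_add[symmetric]) (intro on_curve_intros B)+
      also have "\<dots> = neg B" using add_neg_cancel[OF B B] by simp
      finally have "add A (add A C) = neg B" .
      \<comment> \<open>Cancelling A twice turns the instance for C into B + B = (B + A) + A, which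
        is the claim because B = A + A.\<close>
      then have "add A C = add (neg B) (neg A)"
        using add_neg_cancel[of "add A C" A] A C by (simp add: third_point_commute on_curve_intros)
      then have "add A C = neg (add B A)" using neg_add A B by simp
      then have "C = add (neg (add B A)) (neg A)"
        using add_neg_cancel[of C A] A C by (simp add: third_point_commute)
      then have "C = neg (add (add B A) A)" using neg_add[of "add B A" A] A B on_curve_intros by simp
      then have "add B B = add (add B A) A" unfolding C_def
        using neg_neg A B on_curve_intros by metis
      then show ?thesis using True by (simp add: third_point_commute)
    qed
  qed (use ne B in blast)
qed

section \<open>Iterated sums and the torsion subgroup\<close>

lemma curve_group_simps:
  "P \<otimes>\<^bsub>curve_group\<^esub> Q = add P Q" "\<one>\<^bsub>curve_group\<^esub> = pinf" "carrier curve_group = {P. on_curve P}"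
  by (simp_all add: curve_group_def)

definition nmult :: "proj_plane \<Rightarrow> nat \<Rightarrow> proj_plane"
  where "nmult P n = P [^]\<^bsub>curve_group\<^esub> n"

lemma nmult_simps: "nmult P 0 = pinf" "nmult P (Suc n) = add (nmult P n) P"
  by (simp_all add: nmult_def nat_pow_def curve_group_simps)

lemma on_curve_nmult: "on_curve P \<Longrightarrow> on_curve (nmult P n)"
  by (induction n) (simp_all add: nmult_simps on_curve_intros)

text \<open>With A = (n+1)P one has nP = A + (-P), so each re-bracketing is an instance of
  \<open>alternative\<close> with second point -P or P. Both parities are carried together because
  the next even case starts from the odd one.\<close>

lemma nmult_double:
  assumes P: "on_curve P"
  shows "nmult P (2 * n) = add (nmult P n) (nmult P n) \<and>
    nmult P (2 * n + 1) = add (nmult P n) (nmult P (n + 1))"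
proof (induction n)
  case 0
  show ?case using P by (simp add: nmult_simps third_point_pinf neg_neg)
next
  case (Suc n)
  define A where "A = nmult P (Suc n)"
  have on: "on_curve A" "on_curve (nmult P n)" "on_curve (neg P)"
    using P on_curve_nmult on_curve_intros by (auto simp: A_def)
  have n: "nmult P n = add A (neg P)" using add_neg_cancel on P by (simp add: A_def nmult_simps)
  have even: "nmult P (2 * Suc n) = add A A"
  proof -
    have "nmult P (2 * Suc n) = add (nmult P (2 * n + 1)) P" by (simp add: nmult_simps)
    also have "nmult P (2 * n + 1) = add (nmult P n) A" using Suc by (simp add: A_def)
    also have "add (nmult P n) A = add A (add A (neg P))" unfolding n by (rule add_commute)
    also have "\<dots> = add (add A A) (neg P)" by (rule alternative[OF on(1,3)])
    also have "add \<dots> P = add A A" by (rule add_neg_cancel'[OF on_curve_add[OF on(1) on(1)] P])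
    finally show ?thesis .
  qed
  have "nmult P (2 * Suc n + 1) = add (add A A) P" using even by (simp add: nmult_simps)
  also have "\<dots> = add A (add A P)" by (rule alternative[OF on(1) P, symmetric])
  finally show ?case using even by (simp add: nmult_simps A_def)
qed

text \<open>If nP = O, the sums mP depend only on m modulo n. By pigeonhole two powers of 2 agree
  modulo n, so the x-coordinates of iterated doubles repeat, against
  \<open>dbl_not_periodic\<close>.\<close>

lemma torsion_x_zero:
  assumes "wcurve x y" "n > 0" "nmult (pt x y) n = pinf"
  shows "x = 0"
proof (rule ccontr)
  assume "x \<noteq> 0"
  let ?P = "pt x y"
  have P: "on_curve ?P" using assms(1) by (simp add: on_curve_pt)
  have per: "nmult ?P (m + n) = nmult ?P m" for m
    by (induction m) (simp_all add: nmult_simps assms(3))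
  have "nmult ?P (m + n * k) = nmult ?P m" for m k
  proof (induction k)
    case (Suc k)
    have "m + n * Suc k = (m + n * k) + n" by simp
    then show ?case by (simp only: per Suc)
  qed simp
  from this[of "m mod n" "m div n" for m] have mod: "nmult ?P m = nmult ?P (m mod n)" for m by simp
  have nz: "(dbl ^^ j) x \<noteq> 0" for j using \<open>x \<noteq> 0\<close> by (induction j) (simp_all add: dbl_nonzero)
  have orbit: "\<exists>y'. nmult ?P (2^j) = pt ((dbl ^^ j) x) y' \<and> wcurve ((dbl ^^ j) x) y'" for j
  proof (induction j)
    case 0
    then show ?case using assms(1) P by (simp add: nmult_simps add_pinf)
  next
    case (Suc j)
    then obtain y' where y': "nmult ?P (2^j) = pt ((dbl ^^ j) x) y'" "wcurve ((dbl ^^ j) x) y'" by blast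
    have "nmult ?P (2^Suc j) = add (nmult ?P (2^j)) (nmult ?P (2^j))"
      using nmult_double[OF P, of "2^j"] by simp
    then show ?case using add_self[OF y'(2) nz] y'(1) by simp
  qed
  have "\<not> inj (\<lambda>j. 2^j mod n)"
  proof
    assume "inj (\<lambda>j. 2^j mod n)"
    moreover have "range (\<lambda>j. 2^j mod n) \<subseteq> {..<n}" using assms(2) by auto
    ultimately show False by (meson finite_lessThan infinite_UNIV_nat finite_imageD finite_subset)
  qed
  then obtain i j where "2^i mod n = 2^j mod n" "i \<noteq> j" unfolding inj_def by blast
  then obtain i j where ij: "2^i mod n = 2^j mod n" "i < j" by (metis nat_neq_iff)
  then have "nmult ?P (2^i) = nmult ?P (2^j)" using mod by metis
  then have "(dbl ^^ j) x = (dbl ^^ i) x" using orbit[of i] orbit[of j] by (metis pt_eq_iff)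
  moreover have "(dbl ^^ j) x = (dbl ^^ (j - i)) ((dbl ^^ i) x)"
    using ij(2) by (metis comp_apply funpow_add le_add_diff_inverse2 less_imp_le)
  ultimately show False using dbl_not_periodic[OF nz[of i], of "j - i"] ij(2) by simp
qed

lemma pt_0_0: "hom_pt 1 1 (- 1) = pt 0 0"
  unfolding pt_def by (rule hom_pt_eqI) auto

lemma wcurve_0_0: "wcurve 0 0"
  by (simp add: wcurve_def)

lemma add_pt_0_0: "add (pt 0 0) (pt 0 0) = pinf"
  using third_point_vertical[OF wcurve_0_0] third_point_pinf by simp

lemma torsion_points_curve_group: "torsion_points curve_group = {pinf, pt 0 0}"
proof (intro equalityI subsetI)
  fix P assume "P \<in> torsion_points curve_group"
  then obtain n where P: "on_curve P" "n > 0" "nmult P n = pinf"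
    by (auto simp: torsion_points_def curve_group_simps nmult_def)
  from P(1) show "P \<in> {pinf, pt 0 0}"
  proof (cases rule: on_curve_cases)
    case (2 x y)
    then have "x = 0" using torsion_x_zero P by blast
    moreover from this have "y = 0" using 2 by (simp add: wcurve_def)
    ultimately show ?thesis using 2 by simp
  qed simp
next
  fix P assume "P \<in> {pinf, pt 0 0}"
  moreover have "nmult pinf 1 = pinf" "nmult (pt 0 0) 2 = pinf"
    using add_pinf[OF on_curve_pinf] add_pinf[of "pt 0 0"] add_pt_0_0
    by (simp_all add: nmult_simps numeral_2_eq_2 on_curve_pt wcurve_0_0)
  ultimately have "on_curve P \<and> (\<exists>n > 0. nmult P n = pinf)"
    by (auto simp: on_curve_pinf on_curve_pt wcurve_0_0 intro: exI[of _ 1] exI[of _ 2])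
  then show "P \<in> torsion_points curve_group"
    by (auto simp: torsion_points_def curve_group_simps nmult_def)
qed

theorem proposition4p4:
  "torsion_points curve_group = {hom_pt 1 (- 1) 0, hom_pt 1 1 (- 1)} \<and>
   curve_group\<lparr>carrier := torsion_points curve_group\<rparr> \<cong> integer_mod_group 2"
proof
  show "torsion_points curve_group = {hom_pt 1 (- 1) 0, hom_pt 1 1 (- 1)}"
    unfolding pt_0_0 by (rule torsion_points_curve_group)
  \<comment> \<open>The isomorphism sends O to 0 and D to 1; D + D = O becomes 1 + 1 = 0 modulo
    2.\<close>
  let ?h = "\<lambda>P. if P = pinf then 0 else 1 :: int"
  have carr: "carrier (integer_mod_group 2) = {0, 1}" by (auto simp: carrier_integer_mod_group)
  have "add pinf pinf = pinf" "add pinf (pt 0 0) = pt 0 0" "add (pt 0 0) pinf = pt 0 0"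
    using add_pinf add_commute by (simp_all add: on_curve_pinf on_curve_pt wcurve_0_0)
  then have "?h \<in> iso (curve_group\<lparr>carrier := torsion_points curve_group\<rparr>) (integer_mod_group 2)"
    unfolding iso_def hom_def bij_betw_def torsion_points_curve_group carr
    by (auto simp: mult_integer_mod_group curve_group_simps add_pt_0_0 inj_on_def)
  then show "curve_group\<lparr>carrier := torsion_points curve_group\<rparr> \<cong> integer_mod_group 2"
    unfolding is_iso_def by blast
qed

end
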